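(* For each $n\ge 1$ let $\boldsymbol{\sigma}_n$ be a uniform random separable permutation of size $n$. For any permutation $\pi$ of size $k$, $$\mathbb{E}\big[\widetilde{\mathrm{occ}}(\pi,\boldsymbol{\sigma}_n)\big]\ \xrightarrow[n\to+\infty]{}\ \frac{N_\pi}{2^{k-1}\,\mathrm{Cat}_{k-1}},$$ where $\mathrm{Cat}_k=\frac{1}{k+1}\binom{2k}{k}$ is the $k$-th Catalan number and $N_\pi$ is the number of signed binary trees of $\pi$.
   Context: A permutation of size $n$ is a permutation $\sigma=\sigma_1\cdots\sigma_n$ of $[n]=\{1,\dots,n\}$. For $I\subset[n]$ with $|I|=k$, $\mathrm{pat}_I(\sigma)$ is the permutation of size $k$ whose values are in the same relative order as $(\sigma_i)_{i\in I}$. For $\pi$ of size $k\le n$, $\widetilde{\mathrm{occ}}(\pi,\sigma)=\binom{n}{k}^{-1}\mathrm{card}\{I\subset[n]:|I|=k,\ \mathrm{pat}_I(\sigma)=\pi\}$ (and $0$ if $k>n$). A permutation is separable if it contains no occurrence of the patterns $2413$ and $3142$. A binary tree is a finite plane rooted tree in which every internal (non-leaf) vertex has exactly two ordered children (a single leaf is a binary tree). A signed binary tree is a pair $(t,\varepsilon)$, with $t$ a binary tree and $\varepsilon$ a function from the internal vertices of $t$ to $\{+,-\}$. For permutations $\pi$ of size $k$ and $\sigma$ of size $\ell$, $\oplus[\pi,\sigma]=\pi_1\cdots\pi_k(\sigma_1+k)\cdots(\sigma_\ell+k)$ and $\ominus[\pi,\sigma]=(\pi_1+\ell)\cdots(\pi_k+\ell)\sigma_1\cdots\sigma_\ell$.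 Define $\mathrm{perm}(t,\varepsilon)$ recursively: it is $1$ if $t$ is a leaf; otherwise, if $(t_1,\varepsilon_1),(t_2,\varepsilon_2)$ are the left and right signed subtrees of the root, it is $\oplus[\mathrm{perm}(t_1,\varepsilon_1),\mathrm{perm}(t_2,\varepsilon_2)]$ if the root has sign $+$ and $\ominus[\mathrm{perm}(t_1,\varepsilon_1),\mathrm{perm}(t_2,\varepsilon_2)]$ if the root has sign $-$. A signed binary tree of $\pi$ is a signed binary tree $(t,\varepsilon)$ with $\mathrm{perm}(t,\varepsilon)=\pi$. *)

theory Defs
  imports "HOL-Probability.Probability" "HOL-Library.Tree"
    "HOL-Combinatorics.Multiset_Permutations"
begin

text \<open>
  A permutation of size \<open>n\<close> is given in one-line notation, as the list of its values
  \<open>\<sigma>\<^sub>1, \<dots>, \<sigma>\<^sub>n\<close>.  Lists are indexed from 0, so \<open>\<sigma>\<^sub>i\<close> is \<open>\<sigma> ! (i - 1)\<close>.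
\<close>

abbreviation perms :: "nat \<Rightarrow> nat list set" where
  "perms n \<equiv> permutations_of_set {1..n}"

text \<open>Each value is replaced by its rank among the values present.\<close>

definition standardize :: "nat list \<Rightarrow> nat list" where
  "standardize xs = map (\<lambda>x. card {y \<in> set xs. y \<le> x}) xs"

definition pat :: "nat set \<Rightarrow> nat list \<Rightarrow> nat list" where
  "pat I \<sigma> = standardize (nths \<sigma> {j. Suc j \<in> I})"

definition occ_set :: "nat list \<Rightarrow> nat list \<Rightarrow> nat set set" where
  "occ_set \<pi> \<sigma> = {I. I \<subseteq> {1..length \<sigma>} \<and> card I = length \<pi> \<and> pat I \<sigma> = \<pi>}"

definition occ_density :: "nat list \<Rightarrow> nat list \<Rightarrow> real" where
  "occ_density \<pi> \<sigma> =
     (if length \<pi> \<le> length \<sigma>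
      then real (card (occ_set \<pi> \<sigma>)) / real (length \<sigma> choose length \<pi>) else 0)"

definition separable_perms :: "nat \<Rightarrow> nat list set" where
  "separable_perms n =
     {\<sigma> \<in> perms n. occ_set [2, 4, 1, 3] \<sigma> = {} \<and> occ_set [3, 1, 4, 2] \<sigma> = {}}"

definition dsum :: "nat list \<Rightarrow> nat list \<Rightarrow> nat list" where
  "dsum \<pi> \<sigma> = \<pi> @ map (\<lambda>x. x + length \<pi>) \<sigma>"

definition skew_sum :: "nat list \<Rightarrow> nat list \<Rightarrow> nat list" where
  "skew_sum \<pi> \<sigma> = map (\<lambda>x. x + length \<sigma>) \<pi> @ \<sigma>"

datatype sign = Plus | Minus

text \<open>
  In a tree of the library type \<open>'a tree\<close>, every internal vertex \<open>Node l a r\<close> has exactly two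
  ordered children and carries a label, and a \<open>Leaf\<close> carries none; so \<open>sign tree\<close> is the type
  of pairs of a binary tree and a sign function on its internal vertices.
\<close>

fun perm_of_tree :: "sign tree \<Rightarrow> nat list" where
  "perm_of_tree Leaf = [1]"
| "perm_of_tree (Node l Plus r) = dsum (perm_of_tree l) (perm_of_tree r)"
| "perm_of_tree (Node l Minus r) = skew_sum (perm_of_tree l) (perm_of_tree r)"

definition num_signed_trees :: "nat list \<Rightarrow> nat" where
  "num_signed_trees \<pi> = card {t. perm_of_tree t = \<pi>}"

definition catalan :: "nat \<Rightarrow> real" where
  "catalan k = 1 / (real k + 1) * real ((2 * k) choose k)"

text \<open>
  The facts below show that the cardinalities and the uniform distribution in use are not
  degenerate, and that \<open>pat\<close> is the order-isomorphic permutation.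
\<close>

lemma length_perm_of_tree: "length (perm_of_tree t) = Suc (size t)"
  by (induction t rule: perm_of_tree.induct) (auto simp: dsum_def skew_sum_def)

lemma finite_trees_of_size: "finite {t :: sign tree. size t \<le> n}"
proof (induction n)
  case 0
  have "{t :: sign tree. size t \<le> 0} = {Leaf}" by auto
  then show ?case by simp
next
  case (Suc n)
  let ?A = "{t :: sign tree. size t \<le> n}"
  have "(UNIV :: sign set) = {Plus, Minus}"
    using sign.exhaust by blast
  then have fin: "finite (UNIV :: sign set)" by (metis finite.emptyI finite.insertI)
  have "t = Leaf \<or> (\<exists>l a r. t = Node l a r \<and> l \<in> ?A \<and> r \<in> ?A)"
    if "size t \<le> Suc n" for t :: "sign tree"
    using that by (cases t) auto
  then have "{t :: sign tree. size t \<le> Suc n} \<subseteq>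
      insert Leaf ((\<lambda>(l, a, r). Node l a r) ` (?A \<times> UNIV \<times> ?A))"
    by (force simp: image_iff)
  then show ?case
    by (rule finite_subset) (use Suc fin in auto)
qed

lemma finite_signed_trees: "finite {t. perm_of_tree t = \<pi>}"
  by (rule finite_subset[OF _ finite_trees_of_size[of "length \<pi>"]])
     (auto simp: length_perm_of_tree)

lemma finite_separable_perms: "finite (separable_perms n)"
  unfolding separable_perms_def by simp

lemma standardize_less_iff:
  assumes "i < length xs" "j < length xs"
  shows "standardize xs ! i < standardize xs ! j \<longleftrightarrow> xs ! i < xs ! j"
proof -
  have less: "card {y \<in> set xs. y \<le> xs ! a} < card {y \<in> set xs. y \<le> xs ! b}"
    if "xs ! a < xs ! b" "b < length xs" for a b
  proof (rule psubset_card_mono)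
    have "xs ! b \<in> {y \<in> set xs. y \<le> xs ! b} - {y \<in> set xs. y \<le> xs ! a}"
      using that by auto
    then show "{y \<in> set xs. y \<le> xs ! a} \<subset> {y \<in> set xs. y \<le> xs ! b}"
      using that(1) by fastforce
  qed simp
  show ?thesis
    unfolding standardize_def using assms less[of i j] less[of j i]
    by (cases "xs ! i" "xs ! j" rule: linorder_cases) auto
qed

lemma standardize_perms:
  assumes "distinct xs"
  shows "standardize xs \<in> perms (length xs)"
proof -
  have len: "length (standardize xs) = length xs" by (simp add: standardize_def)
  have dist: "distinct (standardize xs)"
  proof (subst distinct_conv_nth, intro allI impI)
    fix i j
    assume "i < length (standardize xs)" "j < length (standardize xs)" "i \<noteq> j"
    with assms have "xs ! i \<noteq> xs ! j" "i < length xs" "j < length xs"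
      by (auto simp: len nth_eq_iff_index_eq)
    then show "standardize xs ! i \<noteq> standardize xs ! j"
      using standardize_less_iff[of i xs j] standardize_less_iff[of j xs i]
      by (metis linorder_neq_iff)
  qed
  have sub: "set (standardize xs) \<subseteq> {1..length xs}"
  proof
    fix z assume "z \<in> set (standardize xs)"
    then obtain x where x: "x \<in> set xs" "z = card {y \<in> set xs. y \<le> x}"
      by (auto simp: standardize_def)
    have "{y \<in> set xs. y \<le> x} \<noteq> {}" using x by auto
    then have "card {y \<in> set xs. y \<le> x} > 0" by (simp add: card_gt_0_iff)
    moreover have "card {y \<in> set xs. y \<le> x} \<le> card (set xs)"
      by (rule card_mono) auto
    ultimately show "z \<in> {1..length xs}"
      using x card_length[of xs] by auto
  qed
  have "set (standardize xs) = {1..length xs}"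
    by (rule card_subset_eq) (use sub dist len distinct_card in force)+
  with dist show ?thesis by (simp add: permutations_of_set_def)
qed

lemma pat_perms:
  assumes "\<sigma> \<in> perms n" "I \<subseteq> {1..n}"
  shows "pat I \<sigma> \<in> perms (card I)"
proof -
  have d: "distinct \<sigma>" "length \<sigma> = n"
    using assms(1) distinct_card[of \<sigma>] by (auto simp: permutations_of_set_def)
  have "Suc ` {j. j < length \<sigma> \<and> Suc j \<in> I} = I"
  proof
    show "I \<subseteq> Suc ` {j. j < length \<sigma> \<and> Suc j \<in> I}"
    proof
      fix i assume "i \<in> I"
      then show "i \<in> Suc ` {j. j < length \<sigma> \<and> Suc j \<in> I}"
        using assms(2) d by (cases i) (auto simp: image_iff)
    qed
  qed auto
  then have "card {j. j < length \<sigma> \<and> Suc j \<in> I} = card I"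
    by (metis card_image inj_Suc inj_on_subset subset_UNIV)
  then have "length (nths \<sigma> {j. Suc j \<in> I}) = card I"
    by (simp add: length_nths)
  moreover have "distinct (nths \<sigma> {j. Suc j \<in> I})" using d by simp
  ultimately show ?thesis
    unfolding pat_def using standardize_perms by metis
qed

lemma separable_perms_nonempty: "separable_perms n \<noteq> {}"
proof -
  let ?\<sigma> = "[1..<Suc n]"
  have srt: "pat I ?\<sigma> ! i < pat I ?\<sigma> ! j"
    if "i < j" "j < length (pat I ?\<sigma>)" for I i j
  proof -
    have "sorted (nths ?\<sigma> {j. Suc j \<in> I})" "distinct (nths ?\<sigma> {j. Suc j \<in> I})"
      by (auto intro: sorted_nths simp del: upt_Suc)
    then have "sorted_wrt (<) (nths ?\<sigma> {j. Suc j \<in> I})"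
      by (simp add: strict_sorted_iff)
    with that show ?thesis
      by (auto simp: pat_def standardize_less_iff sorted_wrt_iff_nth_less
          standardize_def[THEN arg_cong[of _ _ length]] simp del: upt_Suc)
  qed
  have "pat I ?\<sigma> \<noteq> [2, 4, 1, 3]" for I
    using srt[of 1 2 I] by auto
  moreover have "pat I ?\<sigma> \<noteq> [3, 1, 4, 2]" for I
    using srt[of 0 1 I] by auto
  moreover have "?\<sigma> \<in> perms n"
    by (auto simp: permutations_of_set_def)
  ultimately have "?\<sigma> \<in> separable_perms n"
    by (simp add: separable_perms_def occ_set_def del: upt_Suc)
  then show ?thesis by blast
qed

end

theory Submission
  imports Defs "HOL-Library.Sublist"
begin

text \<open>
  Every separable permutation other than $1$ is a direct sum or a skew sum, and a direct sum is
  uniquely $\sigma \oplus \tau$ with $\sigma, \tau$ separable and $\tau$ indecomposable for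
  $\oplus$.  Splitting the occurrences of a pattern accordingly yields equations for the
  generating functions $S_\pi(z) = \sum_\sigma \mathrm{occ}(\pi, \sigma) z^{|\sigma|}$.  With
  $D = \sqrt{1 - 6z + z^2}$ they become $D S_\pi = \sum S_{\pi'} I_{\pi''} + \ldots$, the sum over
  the proper splittings of $\pi$ and of its reversal, where $I$ counts occurrences in
  indecomposable permutations.  Hence $D^{2k-1} S_\pi$ converges absolutely at the singularity
  $\rho = 3 - 2\sqrt 2$, and its value there satisfies the recursion of the number of signed
  binary trees: it is $2 N_\pi q^k$ with $q$ independent of $\pi$.

  Convergence on the closed disc of radius $\rho$ suffices to transfer the singular behaviour to
  the coefficients, by Tannery's theorem.  As $\sum_{|\pi| = k} S_\pi$ has the coefficients
  $\binom{n}{k} s_n$, with $s_n$ the number of separable permutations, the limit is $N_\pi$ divided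
  by the number of all signed binary trees with $k$ leaves, which is $2^{k-1} \mathrm{Cat}_{k-1}$.
\<close>

section \<open>Occurrences as subsequences\<close>

text \<open>The size is read off the list itself, so that patterns of varying size, the empty one
  included, are handled without an index.\<close>

definition is_perm :: "nat list \<Rightarrow> bool" where
  "is_perm \<sigma> \<longleftrightarrow> \<sigma> \<in> perms (length \<sigma>)"

lemma is_perm_iff: "is_perm \<sigma> \<longleftrightarrow> distinct \<sigma> \<and> set \<sigma> = {1..length \<sigma>}"
  by (auto simp: is_perm_def permutations_of_set_def)

lemma length_perms: "\<sigma> \<in> perms n \<Longrightarrow> length \<sigma> = n"
  using distinct_card[of \<sigma>] by (auto simp: permutations_of_set_def)

lemma is_perm_rev: "is_perm (rev \<sigma>) \<longleftrightarrow> is_perm \<sigma>"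
  by (simp add: is_perm_iff)

section \<open>Standardization and direct sums\<close>

lemma length_standardize [simp]: "length (standardize xs) = length xs"
  by (simp add: standardize_def)

lemma is_perm_standardize: "distinct xs \<Longrightarrow> is_perm (standardize xs)"
  using standardize_perms[of xs] by (simp add: is_perm_def)

lemma standardize_rev: "standardize (rev xs) = rev (standardize xs)"
  by (simp add: standardize_def rev_map)

lemma standardize_map_add: "standardize (map (\<lambda>x. x + c) xs) = standardize xs"
proof -
  have "card {y \<in> (\<lambda>x. x + c) ` set xs. y \<le> x + c} = card {y \<in> set xs. y \<le> x}" for x
  proof -
    have "{y \<in> (\<lambda>x. x + c) ` set xs. y \<le> x + c} = (\<lambda>x. x + c) ` {y \<in> set xs. y \<le> x}" by auto
    then show ?thesis by (simp add: card_image)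
  qed
  then show ?thesis by (simp add: standardize_def)
qed

lemma standardize_perm: "is_perm \<sigma> \<Longrightarrow> standardize \<sigma> = \<sigma>"
proof -
  assume \<sigma>: "is_perm \<sigma>"
  have "card {y \<in> set \<sigma>. y \<le> x} = x" if "x \<in> set \<sigma>" for x
  proof -
    have "{y \<in> set \<sigma>. y \<le> x} = {1..x}" using \<sigma> that by (auto simp: is_perm_iff)
    then show ?thesis by simp
  qed
  then show ?thesis unfolding standardize_def by (intro map_idI) auto
qed

lemma length_dsum [simp]: "length (dsum a b) = length a + length b"
  by (simp add: dsum_def)

lemma dsum_Nil [simp]: "dsum [] b = b" "dsum a [] = a"
  by (simp_all add: dsum_def)

lemma dsum_assoc: "dsum (dsum a b) c = dsum a (dsum b c)"
  by (simp add: dsum_def add_ac)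

lemma dsum_inject: "length a = length a' \<Longrightarrow> dsum a b = dsum a' b' \<longleftrightarrow> a = a' \<and> b = b'"
  by (auto simp: dsum_def inj_on_def dest!: map_injective)

text \<open>Reduces skew sums to direct sums: below, only \<open>dsum\<close> is analysed, and skew
  sums enter through the symmetry \<open>rev\<close>.\<close>

lemma skew_sum_conv_dsum: "skew_sum a b = rev (dsum (rev b) (rev a))"
  by (simp add: dsum_def skew_sum_def rev_map)

lemma is_perm_dsum:
  assumes "is_perm a" "is_perm b"
  shows "is_perm (dsum a b)"
proof -
  have "{1..length a} \<union> (\<lambda>x. x + length a) ` {1..length b} = {1..length a + length b}"
    by (simp only: image_add_atLeastAtMost') auto
  then show ?thesis
    using assms by (auto simp: is_perm_iff dsum_def distinct_map)
qed

text \<open>Ranks inside \<open>xs\<close> do not see the larger entries of \<open>ys\<close>, while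
  each entry of \<open>ys\<close> lies above all of \<open>xs\<close> and gains the number of its
  values, which is \<open>length xs\<close> by distinctness.\<close>

lemma standardize_append:
  assumes "distinct xs" "\<And>x y. x \<in> set xs \<Longrightarrow> y \<in> set ys \<Longrightarrow> x < y"
  shows "standardize (xs @ ys) = dsum (standardize xs) (standardize ys)"
proof -
  have "{y \<in> set (xs @ ys). y \<le> x} = {y \<in> set xs. y \<le> x}" if "x \<in> set xs" for x
    using assms(2)[OF that] by force
  moreover have "card {y \<in> set (xs @ ys). y \<le> x} = card {y \<in> set ys. y \<le> x} + length xs"
    if "x \<in> set ys" for x
  proof -
    have eq: "{y \<in> set (xs @ ys). y \<le> x} = {y \<in> set ys. y \<le> x} \<union> set xs"
      using assms(2)[OF _ that] by force
    have "{y \<in> set ys. y \<le> x} \<inter> set xs = {}" using assms(2) by force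
    then show ?thesis
      unfolding eq using assms(1) by (subst card_Un_disjoint) (auto simp: distinct_card)
  qed
  ultimately show ?thesis
    by (simp add: standardize_def dsum_def)
qed

text \<open>A converse of \<open>is_perm_dsum\<close>: the summands are the standardized halves, and
  a permutation is its own standardization.\<close>

lemma is_perm_dsumE:
  assumes "is_perm \<sigma>" "\<sigma> = xs @ ys" "\<And>x y. x \<in> set xs \<Longrightarrow> y \<in> set ys \<Longrightarrow> x < y"
  obtains a b where "is_perm a" "is_perm b" "length a = length xs" "length b = length ys" "\<sigma> = dsum a b"
proof
  have d: "distinct (xs @ ys)" using assms by (auto simp: is_perm_iff)
  show "is_perm (standardize xs)" "is_perm (standardize ys)"
    using d by (auto intro!: is_perm_standardize)
  have "\<sigma> = standardize (xs @ ys)" using assms standardize_perm by simp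
  also have "\<dots> = dsum (standardize xs) (standardize ys)"
    using d assms(3) by (intro standardize_append) auto
  finally show "\<sigma> = dsum (standardize xs) (standardize ys)" .
qed auto

text \<open>Occurrences are recorded by the values read instead of the positions, because
  subsequences of a concatenation split at once. For distinct entries the count is unchanged, by
  \<open>card_occ_set\<close>.\<close>

definition occs :: "nat list \<Rightarrow> nat list \<Rightarrow> nat list set" where
  "occs \<pi> \<sigma> = {s. subseq s \<sigma> \<and> standardize s = \<pi>}"

lemma finite_subseqs: "finite {s. subseq s xs}"
  unfolding set_subseqs_eq[symmetric] by simp

lemma finite_occs [simp]: "finite (occs \<pi> \<sigma>)"
  by (rule finite_subset[OF _ finite_subseqs[of \<sigma>]]) (auto simp: occs_def)

lemma finite_occ_set: "finite (occ_set \<pi> \<sigma>)"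
  by (rule finite_subset[of _ "Pow {1..length \<sigma>}"]) (auto simp: occ_set_def)

text \<open>Reading off the values at the positions \<open>I\<close> is a bijection: distinct
  entries determine their positions, and every subsequence is read off from some set of
  positions.\<close>

lemma card_occ_set:
  assumes "distinct \<sigma>"
  shows "card (occ_set \<pi> \<sigma>) = card (occs \<pi> \<sigma>)"
proof -
  have len: "length (nths \<sigma> {j. Suc j \<in> I}) = card I" if "I \<subseteq> {1..length \<sigma>}" for I
  proof -
    have "I = Suc ` {j. j < length \<sigma> \<and> Suc j \<in> I}"
    proof (intro equalityI subsetI)
      fix i assume "i \<in> I"
      with that have "i = Suc (i - 1)" "i - 1 < length \<sigma>" by fastforce+
      with \<open>i \<in> I\<close> show "i \<in> Suc ` {j. j < length \<sigma> \<and> Suc j \<in> I}"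
        by (metis (mono_tags, lifting) image_eqI mem_Collect_eq)
    qed auto
    then have "card I = card {j. j < length \<sigma> \<and> Suc j \<in> I}"
      by (metis card_image inj_Suc inj_on_subset subset_UNIV)
    then show ?thesis by (simp add: length_nths)
  qed
  have "bij_betw (\<lambda>I. nths \<sigma> {j. Suc j \<in> I}) (occ_set \<pi> \<sigma>) (occs \<pi> \<sigma>)"
    unfolding bij_betw_def
  proof
    show "inj_on (\<lambda>I. nths \<sigma> {j. Suc j \<in> I}) (occ_set \<pi> \<sigma>)"
    proof (rule inj_onI)
      have sub: "I \<subseteq> J" if IJ: "I \<subseteq> {1..length \<sigma>}" "nths \<sigma> {j. Suc j \<in> I} = nths \<sigma> {j. Suc j \<in> J}" for I J
      proof
        fix i assume "i \<in> I"
        then obtain j where j: "i = Suc j" "j < length \<sigma>"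
          using IJ(1) by (cases i) auto
        with \<open>i \<in> I\<close> have "\<sigma> ! j \<in> set (nths \<sigma> {j. Suc j \<in> I})"
          by (auto simp: set_nths)
        then obtain j' where "\<sigma> ! j = \<sigma> ! j'" "j' < length \<sigma>" "Suc j' \<in> J"
          unfolding IJ(2) by (auto simp: set_nths)
        with j assms show "i \<in> J" by (simp add: nth_eq_iff_index_eq)
      qed
      fix I J assume "I \<in> occ_set \<pi> \<sigma>" "J \<in> occ_set \<pi> \<sigma>"
        and "nths \<sigma> {j. Suc j \<in> I} = nths \<sigma> {j. Suc j \<in> J}"
      then show "I = J" using sub[of I J] sub[of J I] by (simp add: occ_set_def)
    qed
    show "(\<lambda>I. nths \<sigma> {j. Suc j \<in> I}) ` occ_set \<pi> \<sigma> = occs \<pi> \<sigma>"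
    proof (intro equalityI subsetI)
      fix s assume "s \<in> (\<lambda>I. nths \<sigma> {j. Suc j \<in> I}) ` occ_set \<pi> \<sigma>"
      then show "s \<in> occs \<pi> \<sigma>"
        by (auto simp: occ_set_def occs_def pat_def subseq_conv_nths)
    next
      fix s assume s: "s \<in> occs \<pi> \<sigma>"
      then obtain N where N: "s = nths \<sigma> N" by (auto simp: occs_def subseq_conv_nths)
      \<comment> \<open>\<open>nths\<close> ignores indices past the end, so \<open>N\<close> is
        truncated to genuine positions before the shift to counting from 1.\<close>
      define I where "I = Suc ` (N \<inter> {..<length \<sigma>})"
      have I: "I \<subseteq> {1..length \<sigma>}" by (auto simp: I_def)
      have "nths \<sigma> {j. Suc j \<in> I} = s"
      proof -
        have "{j. Suc j \<in> I} = N \<inter> {..<length \<sigma>}" by (auto simp: I_def)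
        moreover have "nths \<sigma> (N \<inter> {..<length \<sigma>}) = nths \<sigma> N"
          unfolding nths_def by (rule arg_cong[where f = "map fst"], rule filter_cong)
            (auto simp: in_set_zip)
        ultimately show ?thesis by (simp add: N)
      qed
      moreover have "I \<in> occ_set \<pi> \<sigma>"
        using I s len[OF I] calculation by (auto simp: occ_set_def pat_def occs_def)
      ultimately show "s \<in> (\<lambda>I. nths \<sigma> {j. Suc j \<in> I}) ` occ_set \<pi> \<sigma>" by blast
    qed
  qed
  then show ?thesis by (rule bij_betw_same_card)
qed

lemma subseq_rev: "subseq (rev s) (rev t) \<longleftrightarrow> subseq s t"
proof -
  have "subseq (rev s) (rev t)" if "subseq s t" for s t :: "'a list"
    using that by (induction rule: list_emb.induct) auto
  from this[of s t] this[of "rev s" "rev t"] show ?thesis by auto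
qed

lemma card_occs_rev: "card (occs (rev \<pi>) (rev \<sigma>)) = card (occs \<pi> \<sigma>)"
proof -
  have "occs (rev \<pi>) (rev \<sigma>) = rev ` occs \<pi> \<sigma>"
    unfolding occs_def
  proof (intro equalityI subsetI)
    fix s assume "s \<in> {s. subseq s (rev \<sigma>) \<and> standardize s = rev \<pi>}"
    then have "rev s \<in> {s. subseq s \<sigma> \<and> standardize s = \<pi>}"
      using subseq_rev[of s "rev \<sigma>"] by (simp add: standardize_rev)
    then show "s \<in> rev ` {s. subseq s \<sigma> \<and> standardize s = \<pi>}" by (force simp: image_iff)
  qed (auto simp: subseq_rev standardize_rev)
  then show ?thesis by (simp add: card_image)
qed

text \<open>Either component may be empty; these cases account for occurrences lying in a single
  summand.\<close>

definition splits :: "nat list \<Rightarrow> (nat list \<times> nat list) set" where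
  "splits \<pi> = {(a, b). is_perm a \<and> is_perm b \<and> dsum a b = \<pi>}"

lemma finite_splits [simp]: "finite (splits \<pi>)"
proof (rule finite_subset)
  show "splits \<pi> \<subseteq> (\<Union>i\<le>length \<pi>. \<Union>j\<le>length \<pi>. perms i \<times> perms j)"
    by (fastforce simp: splits_def is_perm_def simp del: One_nat_def)
qed auto

lemma subseq_map_iff: "subseq s (map f xs) \<longleftrightarrow> (\<exists>t. subseq t xs \<and> s = map f t)"
  by (auto simp: subseq_conv_nths nths_map)

lemma distinct_subseq: "subseq s xs \<Longrightarrow> distinct xs \<Longrightarrow> distinct s"
  by (auto simp: subseq_conv_nths)

lemma set_subseq: "subseq s xs \<Longrightarrow> set s \<subseteq> set xs"
  by (auto simp: subseq_conv_nths dest: in_set_nthsD)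

text \<open>The boundary between the summands cuts an occurrence into a part in
  \<open>\<sigma>\<close> and a part in \<open>\<tau>\<close>, and the standardizations of the two
  parts form a splitting of the pattern.\<close>

lemma card_occs_dsum:
  assumes \<sigma>: "is_perm \<sigma>" and \<tau>: "is_perm \<tau>"
  shows "card (occs \<pi> (dsum \<sigma> \<tau>)) = (\<Sum>(a, b)\<in>splits \<pi>. card (occs a \<sigma>) * card (occs b \<tau>))"
proof -
  define m where "m = length \<sigma>"
  define join where "join = (\<lambda>(s, t). s @ map (\<lambda>x. x + m) t)"
  define Q where "Q = {(s, t). subseq s \<sigma> \<and> subseq t \<tau> \<and> dsum (standardize s) (standardize t) = \<pi>}"
  have small: "x \<le> m" if "subseq s \<sigma>" "x \<in> set s" for s x
    using set_subseq[OF that(1)] that(2) \<sigma> by (auto simp: is_perm_iff m_def)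
  have pos: "x \<ge> 1" if "subseq t \<tau>" "x \<in> set t" for t x
    using set_subseq[OF that(1)] that(2) \<tau> by (auto simp: is_perm_iff)
  have std: "standardize (join (s, t)) = dsum (standardize s) (standardize t)"
    if "subseq s \<sigma>" "subseq t \<tau>" for s t
  proof -
    have "standardize (s @ map (\<lambda>x. x + m) t) = dsum (standardize s) (standardize (map (\<lambda>x. x + m) t))"
      using distinct_subseq[OF that(1)] \<sigma> small[OF that(1)] pos[OF that(2)]
      by (intro standardize_append) (fastforce simp: is_perm_iff)+
    then show ?thesis by (simp add: join_def standardize_map_add)
  qed
  have "bij_betw join Q (occs \<pi> (dsum \<sigma> \<tau>))"
    unfolding bij_betw_def
  proof
    show "inj_on join Q"
    proof (rule inj_onI, clarify)
      fix s t s' t' assume st: "(s, t) \<in> Q" "(s', t') \<in> Q" "join (s, t) = join (s', t')"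
      \<comment> \<open>The boundary is recovered from the values: those from
        \<open>\<sigma>\<close> are at most \<open>m\<close>, the shifted ones from
        \<open>\<tau>\<close> exceed it.\<close>
      have "filter (\<lambda>x. x \<le> m) (join (s, t)) = s" if "(s, t) \<in> Q" for s t
      proof -
        have "\<forall>x\<in>set s. x \<le> m" "\<forall>x\<in>set (map (\<lambda>x. x + m) t). \<not> x \<le> m"
          using that small pos by (fastforce simp: Q_def)+
        then show ?thesis by (simp only: join_def prod.case filter_append filter_False filter_True append_Nil2)
      qed
      with st have "s = s'" by metis
      moreover have "inj (\<lambda>x. x + m)" by simp
      ultimately show "s = s' \<and> t = t'" using st(3) map_injective[of "\<lambda>x. x + m"] by (auto simp: join_def)
    qed
    show "join ` Q = occs \<pi> (dsum \<sigma> \<tau>)"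
    proof (intro equalityI subsetI)
      fix u assume "u \<in> join ` Q"
      then obtain s t where st: "u = join (s, t)" "subseq s \<sigma>" "subseq t \<tau>"
          "dsum (standardize s) (standardize t) = \<pi>"
        by (auto simp: Q_def)
      moreover have "subseq u (dsum \<sigma> \<tau>)"
        using st by (auto simp: join_def dsum_def m_def intro!: list_emb_append_mono subseq_map)
      ultimately show "u \<in> occs \<pi> (dsum \<sigma> \<tau>)" by (auto simp: occs_def std)
    next
      fix u assume u: "u \<in> occs \<pi> (dsum \<sigma> \<tau>)"
      then obtain s t where st: "u = join (s, t)" "subseq s \<sigma>" "subseq t \<tau>"
        by (auto simp: occs_def dsum_def join_def m_def subseq_map_iff elim!: subseq_appendE)
      with u std[OF st(2,3)] have "(s, t) \<in> Q" by (auto simp: Q_def occs_def)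
      with st show "u \<in> join ` Q" by blast
    qed
  qed
  then have "card (occs \<pi> (dsum \<sigma> \<tau>)) = card Q" by (simp add: bij_betw_same_card)
  \<comment> \<open>The pairs are sorted by their two standardizations; distinct splittings give
    disjoint products.\<close>
  also have "Q = (\<Union>(a, b)\<in>splits \<pi>. occs a \<sigma> \<times> occs b \<tau>)"
  proof (intro equalityI subsetI)
    fix p assume p: "p \<in> Q"
    obtain s t where "p = (s, t)" by force
    with p have st: "p = (s, t)" "subseq s \<sigma>" "subseq t \<tau>" "dsum (standardize s) (standardize t) = \<pi>"
      by (auto simp: Q_def)
    have "(standardize s, standardize t) \<in> splits \<pi>"
      using st \<sigma> \<tau> distinct_subseq is_perm_standardize
      by (auto simp: splits_def is_perm_iff)
    with st show "p \<in> (\<Union>(a, b)\<in>splits \<pi>. occs a \<sigma> \<times> occs b \<tau>)"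
      by (force simp: occs_def)
  qed (auto simp: Q_def occs_def splits_def)
  also have "card \<dots> = (\<Sum>(a, b)\<in>splits \<pi>. card (occs a \<sigma>) * card (occs b \<tau>))"
  proof -
    have "\<forall>p\<in>splits \<pi>. \<forall>q\<in>splits \<pi>. p \<noteq> q \<longrightarrow>
        (case p of (a, b) \<Rightarrow> occs a \<sigma> \<times> occs b \<tau>) \<inter> (case q of (a, b) \<Rightarrow> occs a \<sigma> \<times> occs b \<tau>) = {}"
      by (auto simp: occs_def)
    then show ?thesis by (subst card_UN_disjoint) (auto simp: case_prod_unfold)
  qed
  finally show ?thesis .
qed

section \<open>Decomposing separable permutations\<close>

text \<open>The order is a parameter: \<open>(<)\<close> gives the cuts of direct sums,
  \<open>(>)\<close> those of skew sums.\<close>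

definition cut :: "('a \<Rightarrow> 'a \<Rightarrow> bool) \<Rightarrow> 'a list \<Rightarrow> bool" where
  "cut lt xs \<longleftrightarrow> (\<exists>A B. xs = A @ B \<and> A \<noteq> [] \<and> B \<noteq> [] \<and> (\<forall>a\<in>set A. \<forall>b\<in>set B. lt a b))"

text \<open>For \<open>(<)\<close> the two negated conjunctions exclude 2413 and 3142, in this
  order.\<close>

definition avoids :: "('a \<Rightarrow> 'a \<Rightarrow> bool) \<Rightarrow> 'a list \<Rightarrow> bool" where
  "avoids lt xs \<longleftrightarrow> (\<forall>a b c d. subseq [a, b, c, d] xs \<longrightarrow>
     \<not> (lt c a \<and> lt a d \<and> lt d b) \<and> \<not> (lt b d \<and> lt d a \<and> lt a c))"

text \<open>Reversing the order exchanges the two patterns, so one extension step below serves both orders.\<close>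

lemma avoids_conversep: "avoids lt\<inverse>\<inverse> xs \<longleftrightarrow> avoids lt xs"
  by (auto simp: avoids_def)

lemma avoids_subseq: "avoids lt xs \<Longrightarrow> subseq ys xs \<Longrightarrow> avoids lt ys"
  unfolding avoids_def by (meson subseq_order.trans)

text \<open>If neither $x$ nor the first indecomposable block $A$ of $ys$ gives a cut, then $A$ is cut into
  $C > E$ and $x$ lies between values of $C$ and $E$; with a value of $ys$ beyond $A$ this makes
  the pattern $3142$.\<close>

lemma cut_snoc:
  assumes trans: "\<And>x y z. lt x y \<Longrightarrow> lt y z \<Longrightarrow> lt x z"
    and irrefl: "\<And>x. \<not> lt x x"
    and total: "\<And>x y. x \<noteq> y \<Longrightarrow> lt x y \<or> lt y x"
    and dist: "distinct (ys @ [x])" and av: "avoids lt (ys @ [x])" and "cut lt ys"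
    and IH: "\<And>zs. subseq zs ys \<Longrightarrow> length zs \<ge> 2 \<Longrightarrow> cut lt zs \<or> cut lt\<inverse>\<inverse> zs"
  shows "cut lt (ys @ [x]) \<or> cut lt\<inverse>\<inverse> (ys @ [x])"
proof -
  define P where "P A \<longleftrightarrow> (\<exists>B. ys = A @ B \<and> A \<noteq> [] \<and> B \<noteq> [] \<and> (\<forall>a\<in>set A. \<forall>b\<in>set B. lt a b))" for A
  have "\<exists>A. P A" using \<open>cut lt ys\<close> by (auto simp: P_def cut_def)
  then obtain A where "P A" and min: "\<And>C. P C \<Longrightarrow> length A \<le> length C"
    using ex_has_least_nat[of P _ length] by metis
  then obtain B where B: "ys = A @ B" "A \<noteq> []" "B \<noteq> []" "\<And>a b. a \<in> set A \<Longrightarrow> b \<in> set B \<Longrightarrow> lt a b"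
    by (auto simp: P_def)
  have "\<not> cut lt A"
  proof
    assume "cut lt A"
    then obtain C E where CE: "A = C @ E" "C \<noteq> []" "E \<noteq> []" "\<forall>a\<in>set C. \<forall>b\<in>set E. lt a b"
      by (auto simp: cut_def)
    have "P C" unfolding P_def by (rule exI[of _ "E @ B"]) (use B CE in auto)
    from min[OF this] CE show False by simp
  qed
  consider "\<forall>a\<in>set A. lt a x" | "\<forall>y\<in>set ys. lt x y"
    | a0 y0 where "a0 \<in> set A" "\<not> lt a0 x" "y0 \<in> set ys" "\<not> lt x y0" by blast
  then show ?thesis
  proof cases
    case 1
    then have "cut lt (ys @ [x])"
      unfolding cut_def by (intro exI[of _ A] exI[of _ "B @ [x]"]) (use B in auto)
    then show ?thesis ..
  next
    case 2
    then have "cut lt\<inverse>\<inverse> (ys @ [x])"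
      unfolding cut_def by (intro exI[of _ ys] exI[of _ "[x]"]) (use B in auto)
    then show ?thesis ..
  next
    case 3
    have x: "lt x a0" "lt y0 x" using total[of x a0] total[of x y0] 3 dist B(1) by auto
    have y0: "y0 \<in> set A"
      using 3 B(1) B(4)[OF 3(1)] x trans irrefl by (metis UnE set_append)
    have "a0 \<noteq> y0" using x trans irrefl by blast
    then have "length A \<ge> 2" using 3(1) y0
      by (cases A rule: remdups_adj.cases) auto
    with IH[of A] \<open>\<not> cut lt A\<close> have "cut lt\<inverse>\<inverse> A" by (auto simp: B(1))
    then obtain C E where CE: "A = C @ E" "C \<noteq> []" "E \<noteq> []" "\<And>a b. a \<in> set C \<Longrightarrow> b \<in> set E \<Longrightarrow> lt b a"
      by (auto simp: cut_def)
    obtain c where c: "c \<in> set C" "lt x c"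
      using 3(1) x CE trans by (metis UnE set_append hd_in_set)
    obtain e where e: "e \<in> set E" "lt e x"
      using y0 x CE trans by (metis UnE set_append hd_in_set)
    obtain b where b: "b \<in> set B" using B(3) hd_in_set by blast
    have "lt c b" using B(4)[of c b] c b CE(1) by auto
    have "subseq ([c] @ [e] @ [b] @ [x]) (C @ E @ B @ [x])"
      using b c e by (intro list_emb_append_mono) (auto simp: subseq_singleton_left)
    then have "subseq [c, e, b, x] (ys @ [x])" by (simp add: B(1) CE(1))
    with av \<open>lt c b\<close> c e show ?thesis by (auto simp: avoids_def)
  qed
qed

text \<open>The last entry is removed, the rest has a cut in one of the two orders, and
  \<open>cut_snoc\<close> for that order restores the entry. Induction on the length supplies cuts
  of all shorter subsequences, which \<open>cut_snoc\<close> asks for.\<close>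

lemma cut_if_avoids:
  fixes xs :: "'a :: linorder list"
  assumes "distinct xs" "avoids (<) xs" "length xs \<ge> 2"
  shows "cut (<) xs \<or> cut (>) xs"
  using assms
proof (induction xs rule: length_induct)
  case (1 xs)
  obtain ys x where xs: "xs = ys @ [x]" using "1.prems" by (cases xs rule: rev_cases) auto
  have conv: "(<)\<inverse>\<inverse> = ((>) :: 'a \<Rightarrow> 'a \<Rightarrow> bool)" "(>)\<inverse>\<inverse> = ((<) :: 'a \<Rightarrow> 'a \<Rightarrow> bool)"
    by (auto simp: fun_eq_iff)
  have sub: "cut (<) zs \<or> cut (>) zs" if "subseq zs ys" "length zs \<ge> 2" for zs
  proof -
    have "subseq zs xs" "length zs < length xs"
      using that list_emb_length[OF that(1)] by (auto simp: xs)
    moreover from this have "distinct zs" "avoids (<) zs"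
      using "1.prems" distinct_subseq avoids_subseq by blast+
    ultimately show ?thesis using "1.IH" that by blast
  qed
  show ?case
  proof (cases "length ys \<ge> 2")
    case True
    then consider "cut (<) ys" | "cut (>) ys" using sub by blast
    then show ?thesis
    proof cases
      case 1
      have "cut (<) (ys @ [x]) \<or> cut (<)\<inverse>\<inverse> (ys @ [x])"
        by (rule cut_snoc) (use 1 "1.prems" sub xs conv in auto)
      then show ?thesis by (simp add: xs conv)
    next
      case 2
      have "cut (>) (ys @ [x]) \<or> cut (>)\<inverse>\<inverse> (ys @ [x])"
        by (rule cut_snoc) (use 2 "1.prems" sub xs conv avoids_conversep[of "(<)" xs] in auto)
      then show ?thesis by (auto simp: xs conv)
    qed
  next
    case False
    then obtain y where "ys = [y]" using "1.prems" xs by (cases ys; cases "tl ys") auto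
    then have "xs = [y] @ [x]" "y < x \<or> x < y" using "1.prems" xs by auto
    moreover have "cut lt ([y] @ [x])" if "lt y x" for lt
      unfolding cut_def by (rule exI[of _ "[y]"], rule exI[of _ "[x]"]) (use that in auto)
    ultimately show ?thesis by metis
  qed
qed

text \<open>Leaving out the empty list makes every direct sum of two members a proper
  decomposition.\<close>

definition separables :: "nat list set" where
  "separables = {\<sigma>. \<sigma> \<noteq> [] \<and> \<sigma> \<in> separable_perms (length \<sigma>)}"

text \<open>Phrased by numbers of occurrences, so that the counting formulas for \<open>dsum\<close>
  and \<open>rev\<close> apply directly.\<close>

lemma separable_iff:
  "\<sigma> \<in> separables \<longleftrightarrow> \<sigma> \<noteq> [] \<and> is_perm \<sigma> \<and> card (occs [2, 4, 1, 3] \<sigma>) = 0 \<and> card (occs [3, 1, 4, 2] \<sigma>) = 0"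
proof -
  have "occ_set \<pi> \<sigma> = {} \<longleftrightarrow> card (occs \<pi> \<sigma>) = 0" if "is_perm \<sigma>" for \<pi>
    using card_occ_set[of \<sigma> \<pi>] that finite_occ_set[of \<pi> \<sigma>]
    by (metis card_eq_0_iff is_perm_iff)
  then show ?thesis by (auto simp: separables_def separable_perms_def is_perm_def simp del: card_0_eq)
qed

lemma separable_is_perm: "\<sigma> \<in> separables \<Longrightarrow> is_perm \<sigma>"
  and separable_not_Nil: "\<sigma> \<in> separables \<Longrightarrow> \<sigma> \<noteq> []"
  by (auto simp: separable_iff)

lemma separable_avoids:
  assumes "\<sigma> \<in> separables"
  shows "avoids (<) \<sigma>"
  unfolding avoids_def
proof (intro allI impI)
  fix a b c d assume sub: "subseq [a, b, c, d] \<sigma>"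
  have empty: "standardize [a, b, c, d] \<noteq> [2, 4, 1, 3]" "standardize [a, b, c, d] \<noteq> [3, 1, 4, 2]"
    using assms sub card_0_eq[OF finite_occs] unfolding separable_iff occs_def by blast+
  have "\<not> (c < a \<and> a < d \<and> d < b)"
  proof
    assume lt: "c < a \<and> a < d \<and> d < b"
    then have "{y \<in> {a, b, c, d}. y \<le> a} = {a, c}" "{y \<in> {a, b, c, d}. y \<le> b} = {a, b, c, d}"
      "{y \<in> {a, b, c, d}. y \<le> c} = {c}" "{y \<in> {a, b, c, d}. y \<le> d} = {a, c, d}" by auto
    with lt empty(1) show False by (simp add: standardize_def)
  qed
  moreover have "\<not> (b < d \<and> d < a \<and> a < c)"
  proof
    assume lt: "b < d \<and> d < a \<and> a < c"
    then have "{y \<in> {a, b, c, d}. y \<le> a} = {a, b, d}" "{y \<in> {a, b, c, d}. y \<le> b} = {b}"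
      "{y \<in> {a, b, c, d}. y \<le> c} = {a, b, c, d}" "{y \<in> {a, b, c, d}. y \<le> d} = {b, d}" by auto
    with lt empty(2) show False by (simp add: standardize_def)
  qed
  ultimately show "\<not> (c < a \<and> a < d \<and> d < b) \<and> \<not> (b < d \<and> d < a \<and> a < c)" ..
qed

section \<open>Separability under direct sums and reversal\<close>

lemma occs_Nil [simp]: "occs [] \<sigma> = {[]}"
  by (auto simp: occs_def standardize_def)

text \<open>The first summand of a proper splitting would be a prefix of some length
  \<open>i\<close> with all values at most \<open>i\<close>; \<open>big\<close> excludes
  this.\<close>

lemma splits_trivial:
  assumes \<pi>: "is_perm \<pi>" and big: "\<And>i. 0 < i \<Longrightarrow> i < length \<pi> \<Longrightarrow> \<exists>j<i. \<pi> ! j > i"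
  shows "splits \<pi> = {([], \<pi>), (\<pi>, [])}"
proof -
  have triv: "a = [] \<or> b = []" if ab: "is_perm a" "dsum a b = \<pi>" for a b
  proof (rule ccontr)
    assume *: "\<not> (a = [] \<or> b = [])"
    have "length \<pi> = length a + length b" using ab(2) by auto
    with * big[of "length a"] obtain j where j: "j < length a" "\<pi> ! j > length a" by auto
    moreover have "\<pi> ! j = a ! j" using j(1) ab(2) by (auto simp: dsum_def nth_append)
    ultimately show False using ab(1) nth_mem[OF j(1)] by (simp add: is_perm_iff)
  qed
  have "splits \<pi> \<subseteq> {([], \<pi>), (\<pi>, [])}"
    unfolding splits_def by (clarify, metis triv dsum_Nil insertCI)
  moreover have "is_perm []" by (simp add: is_perm_iff)
  ultimately show ?thesis using \<pi> by (auto simp: splits_def)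
qed

lemma splits_simple:
  "splits [2, 4, 1, 3] = {([], [2, 4, 1, 3]), ([2, 4, 1, 3], [])}"
  "splits [3, 1, 4, 2] = {([], [3, 1, 4, 2]), ([3, 1, 4, 2], [])}"
proof -
  have "is_perm [2, 4, 1, 3]" "is_perm [3, 1, 4, 2]" by (auto simp: is_perm_iff)
  moreover have "\<exists>j<i. [2, 4, 1, 3] ! j > i" "\<exists>j<i. [3, 1, 4, 2] ! j > i" if "0 < i" "i < 4" for i :: nat
  proof -
    from that consider "i = 1" | "i = 2" | "i = 3" by linarith
    note cases = this
    from cases show "\<exists>j<i. [2, 4, 1, 3] ! j > i"
      by cases (rule exI[of _ 0], simp, rule exI[of _ 1], simp, rule exI[of _ 1], simp)
    from cases show "\<exists>j<i. [3, 1, 4, 2] ! j > i"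
      by cases (rule exI[of _ 0], simp, rule exI[of _ 0], simp, rule exI[of _ 2], simp)
  qed
  ultimately show "splits [2, 4, 1, 3] = {([], [2, 4, 1, 3]), ([2, 4, 1, 3], [])}"
    "splits [3, 1, 4, 2] = {([], [3, 1, 4, 2]), ([3, 1, 4, 2], [])}"
    by (auto intro!: splits_trivial simp del: One_nat_def)
qed

text \<open>Both forbidden patterns have only the trivial splittings, so each of their occurrences
  in a direct sum lies in one summand.\<close>

lemma dsum_separable_iff:
  assumes "is_perm a" "is_perm b" "a \<noteq> []" "b \<noteq> []"
  shows "dsum a b \<in> separables \<longleftrightarrow> a \<in> separables \<and> b \<in> separables"
proof -
  have "dsum a b \<noteq> []" using assms by (simp add: dsum_def)
  then show ?thesis
    using assms is_perm_dsum[OF assms(1,2)]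
    unfolding separable_iff card_occs_dsum[OF assms(1,2)] splits_simple by (auto simp del: card_0_eq)
qed

lemma rev_separable_iff: "rev \<sigma> \<in> separables \<longleftrightarrow> \<sigma> \<in> separables"
  using card_occs_rev[of "[2, 4, 1, 3]" \<sigma>] card_occs_rev[of "[3, 1, 4, 2]" \<sigma>]
  by (auto simp: separable_iff is_perm_rev simp del: card_0_eq)

definition sum_decomposables :: "nat list set" where
  "sum_decomposables = {dsum a b | a b. a \<in> separables \<and> b \<in> separables}"

definition sum_indecomposables :: "nat list set" where
  "sum_indecomposables = separables - sum_decomposables"

lemma decomposable_subset: "sum_decomposables \<subseteq> separables"
  using dsum_separable_iff separable_is_perm separable_not_Nil by (auto simp: sum_decomposables_def)

lemma decomposableI: "is_perm a \<Longrightarrow> is_perm b \<Longrightarrow> a \<noteq> [] \<Longrightarrow> b \<noteq> [] \<Longrightarrow> dsum a b \<in> separables \<Longrightarrow> dsum a b \<in> sum_decomposables"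
  using dsum_separable_iff by (auto simp: sum_decomposables_def)

lemma decomposable_if_cut:
  assumes "\<sigma> \<in> separables" "cut (<) \<sigma>"
  shows "\<sigma> \<in> sum_decomposables"
proof -
  obtain A B where AB: "\<sigma> = A @ B" "A \<noteq> []" "B \<noteq> []" "\<And>x y. x \<in> set A \<Longrightarrow> y \<in> set B \<Longrightarrow> x < y"
    using assms(2) by (auto simp: cut_def)
  obtain a b where ab: "is_perm a" "is_perm b" "length a = length A" "length b = length B" "\<sigma> = dsum a b"
    using is_perm_dsumE[OF separable_is_perm[OF assms(1)] AB(1,4)] by blast
  with AB have "a \<noteq> []" "b \<noteq> []" by auto
  with ab assms(1) show ?thesis using decomposableI[of a b] by simp
qed

text \<open>From size 2 on, \<open>cut_if_avoids\<close> provides a cut. A cut for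
  \<open>(>)\<close> becomes one for \<open>(<)\<close> after reversal, so the reversed direct sums
  are the skew sums.\<close>

lemma separable_decomp: "separables = {[1]} \<union> sum_decomposables \<union> rev ` sum_decomposables"
proof
  have "[1] \<in> separables"
  proof -
    have "occs \<pi> [1] = {}" if "length \<pi> = 4" for \<pi>
      using that list_emb_length[of "(=)" _ "[1]"] by (fastforce simp: occs_def)
    then show ?thesis by (simp add: separable_iff is_perm_iff)
  qed
  then show "{[1]} \<union> sum_decomposables \<union> rev ` sum_decomposables \<subseteq> separables"
    using decomposable_subset rev_separable_iff by auto
  show "separables \<subseteq> {[1]} \<union> sum_decomposables \<union> rev ` sum_decomposables"
  proof
    fix \<sigma> assume \<sigma>: "\<sigma> \<in> separables"
    then have p: "distinct \<sigma>" "set \<sigma> = {1..length \<sigma>}" "\<sigma> \<noteq> []"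
      using separable_is_perm separable_not_Nil is_perm_iff by auto
    show "\<sigma> \<in> {[1]} \<union> sum_decomposables \<union> rev ` sum_decomposables"
    proof (cases "length \<sigma> \<ge> 2")
      case True
      with cut_if_avoids[OF p(1) separable_avoids[OF \<sigma>]] consider "cut (<) \<sigma>" | "cut (>) \<sigma>" by blast
      then show ?thesis
      proof cases
        case 1
        then show ?thesis using decomposable_if_cut \<sigma> by blast
      next
        case 2
        then obtain A B where AB: "\<sigma> = A @ B" "A \<noteq> []" "B \<noteq> []" "\<forall>x\<in>set A. \<forall>y\<in>set B. x > y"
          by (auto simp: cut_def)
        then have "cut (<) (rev \<sigma>)"
          unfolding cut_def by (intro exI[of _ "rev B"] exI[of _ "rev A"]) auto
        then have "rev \<sigma> \<in> sum_decomposables" using decomposable_if_cut \<sigma> rev_separable_iff by blast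
        then show ?thesis by (metis UnI2 image_eqI rev_rev_ident)
      qed
    next
      case False
      with p(3) obtain x where "\<sigma> = [x]" by (cases \<sigma>; cases "tl \<sigma>") auto
      with p(2) show ?thesis by simp
    qed
  qed
qed

section \<open>Disjointness and uniqueness of the decompositions\<close>

lemma length_decomposable: "\<sigma> \<in> sum_decomposables \<Longrightarrow> length \<sigma> \<ge> 2"
proof -
  assume "\<sigma> \<in> sum_decomposables"
  then obtain a b where "\<sigma> = dsum a b" "a \<noteq> []" "b \<noteq> []" using separable_not_Nil by (auto simp: sum_decomposables_def)
  then show ?thesis by (cases a; cases b) auto
qed

text \<open>An invariant separating direct sums from skew sums: reversal exchanges the first and
  last entries and so turns the inequality round.\<close>

lemma decomposable_hd_last: "\<sigma> \<in> sum_decomposables \<Longrightarrow> hd \<sigma> < last \<sigma>"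
proof -
  assume "\<sigma> \<in> sum_decomposables"
  then obtain a b where ab: "\<sigma> = dsum a b" "a \<noteq> []" "b \<noteq> []" "is_perm a" "is_perm b"
    using separable_not_Nil separable_is_perm by (auto simp: sum_decomposables_def)
  then have "hd a \<le> length a" "last b \<ge> 1"
    using hd_in_set[of a] last_in_set[of b] by (auto simp: is_perm_iff simp del: hd_in_set last_in_set)
  with ab show ?thesis by (simp add: dsum_def last_map)
qed

lemma separable_decomp_disjoint: "[1] \<notin> sum_decomposables" "[1] \<notin> rev ` sum_decomposables" "sum_decomposables \<inter> rev ` sum_decomposables = {}"
proof -
  show "[1] \<notin> sum_decomposables" "[1] \<notin> rev ` sum_decomposables" using length_decomposable by fastforce+
  have False if "\<sigma> \<in> sum_decomposables" "rev \<sigma> \<in> sum_decomposables" for \<sigma>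
    using decomposable_hd_last[OF that(1)] decomposable_hd_last[OF that(2)] by (simp add: hd_rev last_rev)
  then show "sum_decomposables \<inter> rev ` sum_decomposables = {}" by auto
qed

text \<open>Two cuts of the same permutation have a common refinement; \<open>c\<close> is the
  standardized block between them.\<close>

lemma dsum_eq_dsum_shorter:
  assumes "is_perm a" "is_perm b" "is_perm a'" "is_perm b'" "dsum a b = dsum a' b'" "length a < length a'"
  obtains c where "is_perm c" "c \<noteq> []" "a' = dsum a c" "b = dsum c b'"
proof -
  define k where "k = length a"
  have eq: "a @ map (\<lambda>x. x + k) b = a' @ map (\<lambda>x. x + length a') b'"
    using assms(5) by (simp add: dsum_def k_def)
  \<comment> \<open>The block between the two cuts, with its original values.\<close>
  define m where "m = drop k a'"
  have a': "a' = a @ m"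
    using arg_cong[OF eq, of "take k"] append_take_drop_id[of k a'] assms(6) by (simp add: m_def k_def)
  have d: "distinct (a @ m)" "set a = {1..k}" "set a \<union> set m = {1..length a'}"
    using assms(1,3) a' by (auto simp: is_perm_iff k_def)
  have "x < y" if "x \<in> set a" "y \<in> set m" for x y
  proof -
    have "y \<notin> {1..k}" "1 \<le> y" using d that by auto
    with that d(2) show ?thesis by auto
  qed
  from is_perm_dsumE[OF assms(3) a' this]
  obtain a1 c where c: "is_perm a1" "is_perm c" "length a1 = length a" "a' = dsum a1 c"
    by metis
  have "a1 @ map (\<lambda>x. x + length a1) c = a @ m" using c(4) a' by (simp add: dsum_def)
  with c(3) have "a1 = a" by simp
  have "dsum a b = dsum a (dsum c b')" using assms(5) c(4) \<open>a1 = a\<close> by (simp add: dsum_assoc)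
  then have "b = dsum c b'" by (simp add: dsum_inject)
  moreover have "c \<noteq> []" using c(4) assms(6) \<open>a1 = a\<close> by auto
  ultimately show ?thesis using that c \<open>a1 = a\<close> by blast
qed

text \<open>Uniqueness: if the left parts had different lengths, \<open>dsum_eq_dsum_shorter\<close>
  would decompose one of the right parts. Existence: a decomposable right part gives its left
  summand to \<open>a\<close> by associativity, until it is indecomposable.\<close>

lemma bij_betw_dsum: "bij_betw (\<lambda>(a, b). dsum a b) (separables \<times> sum_indecomposables) sum_decomposables"
  unfolding bij_betw_def
proof
  have nlt: "\<not> length a < length a'"
    if "a \<in> separables" "b \<in> sum_indecomposables" "a' \<in> separables" "b' \<in> sum_indecomposables" "dsum a b = dsum a' b'" for a b a' b'
  proof
    have p: "is_perm a" "is_perm b" "is_perm a'" "is_perm b'" "b' \<noteq> []"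
      using that separable_is_perm separable_not_Nil by (auto simp: sum_indecomposables_def)
    assume "length a < length a'"
    from dsum_eq_dsum_shorter[OF p(1-4) that(5) this]
    obtain c where "is_perm c" "c \<noteq> []" "b = dsum c b'" by blast
    with p decomposableI[of c b'] that(2) show False by (auto simp: sum_indecomposables_def)
  qed
  show "inj_on (\<lambda>(a, b). dsum a b) (separables \<times> sum_indecomposables)"
  proof (rule inj_onI, clarify)
    fix a b a' b' assume *: "a \<in> separables" "b \<in> sum_indecomposables" "a' \<in> separables" "b' \<in> sum_indecomposables" "dsum a b = dsum a' b'"
    have "length a = length a'" using nlt[of a b a' b'] nlt[of a' b' a b] * by simp
    with * show "a = a' \<and> b = b'" by (simp add: dsum_inject)
  qed
  \<comment> \<open>The induction runs on the length of \<open>b\<close>, while \<open>a\<close>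
    grows and must stay arbitrary.\<close>
  have "\<exists>a'\<in>separables. \<exists>b'\<in>sum_indecomposables. dsum a b = dsum a' b'" if "a \<in> separables" "b \<in> separables" for a b
    using that
  proof (induction "length b" arbitrary: a b rule: less_induct)
    case less
    show ?case
    proof (cases "b \<in> sum_indecomposables")
      case False
      with less.prems obtain c d where cd: "b = dsum c d" "c \<in> separables" "d \<in> separables"
        by (auto simp: sum_indecomposables_def sum_decomposables_def)
      have "dsum a c \<in> separables"
        using dsum_separable_iff less.prems cd separable_is_perm separable_not_Nil by auto
      moreover have "length d < length b" using cd separable_not_Nil by auto
      ultimately show ?thesis using less.hyps[of d "dsum a c"] cd by (simp add: dsum_assoc)
    qed (use less in blast)
  qed
  then show "(\<lambda>(a, b). dsum a b) ` (separables \<times> sum_indecomposables) = sum_decomposables"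
    unfolding sum_decomposables_def sum_indecomposables_def image_def by auto
qed

section \<open>Power series absolutely convergent at a point\<close>

text \<open>Absolute convergence is included so that the notion is stable under products even when
  \<open>r\<close> is on the boundary of the disc of convergence.\<close>

definition has_abs_value :: "real fps \<Rightarrow> real \<Rightarrow> real \<Rightarrow> bool" where
  "has_abs_value f r v \<longleftrightarrow>
     summable (\<lambda>n. norm (fps_nth f n * r ^ n)) \<and> (\<lambda>n. fps_nth f n * r ^ n) sums v"

lemma has_abs_value_unique: "has_abs_value f r v \<Longrightarrow> has_abs_value f r w \<Longrightarrow> v = w"
  unfolding has_abs_value_def using sums_unique2 by blast

lemma has_abs_valueE:
  assumes "summable (\<lambda>n. norm (fps_nth f n * r ^ n))"
  obtains v where "has_abs_value f r v"
  using assms summable_norm_cancel[OF assms] unfolding has_abs_value_def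
  by (meson summable_sums)

lemma has_abs_value_const: "has_abs_value (fps_const c) r c"
proof -
  have "(\<lambda>n. fps_nth (fps_const c) n * r ^ n) = (\<lambda>n. if n = 0 then c else 0)"
    by auto
  moreover have "(\<lambda>n. norm (fps_nth (fps_const c) n * r ^ n)) = (\<lambda>n. if n = 0 then norm c else 0)"
    by auto
  ultimately show ?thesis
    unfolding has_abs_value_def using sums_single[of 0 "\<lambda>_. c"] by simp
qed

lemma has_abs_value_0: "has_abs_value 0 r 0"
  using has_abs_value_const[of 0] by simp

lemma has_abs_value_1: "has_abs_value 1 r 1"
  using has_abs_value_const[of 1] by simp

lemma has_abs_value_numeral: "has_abs_value (numeral k) r (numeral k)"
  using has_abs_value_const[of "numeral k"] by (simp add: numeral_fps_const)

lemma has_abs_value_X: "has_abs_value fps_X r r"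
proof -
  have "(\<lambda>n. fps_nth fps_X n * r ^ n) = (\<lambda>n. if n = 1 then r else 0)"
    by (auto simp: fps_X_def)
  moreover have "(\<lambda>n. norm (fps_nth fps_X n * r ^ n)) = (\<lambda>n. if n = 1 then norm r else 0)"
    by (auto simp: fps_X_def)
  ultimately show ?thesis
    unfolding has_abs_value_def using sums_single[of 1 "\<lambda>_. r"] by simp
qed

lemma has_abs_value_add:
  assumes "has_abs_value f r v" "has_abs_value g r w"
  shows "has_abs_value (f + g) r (v + w)"
proof -
  have "summable (\<lambda>n. norm (fps_nth (f + g) n * r ^ n))"
    by (rule summable_comparison_test'[of "\<lambda>n. norm (fps_nth f n * r ^ n) + norm (fps_nth g n * r ^ n)" 0])
       (use assms in \<open>auto intro: summable_add abs_triangle_ineq simp: has_abs_value_def distrib_right\<close>)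
  then show ?thesis
    using assms sums_add unfolding has_abs_value_def by (fastforce simp: distrib_right)
qed

lemma has_abs_value_mult:
  assumes "has_abs_value f r v" "has_abs_value g r w"
  shows "has_abs_value (f * g) r (v * w)"
proof -
  let ?f = "\<lambda>n. fps_nth f n * r ^ n" and ?g = "\<lambda>n. fps_nth g n * r ^ n"
  have prod: "fps_nth (f * g) n * r ^ n = (\<Sum>i\<le>n. ?f i * ?g (n - i))" for n
    unfolding fps_mult_nth atLeast0AtMost sum_distrib_right
    by (intro sum.cong) (auto simp: power_add[symmetric] mult_ac)
  have "norm (fps_nth (f * g) n * r ^ n) \<le> (\<Sum>i\<le>n. norm (?f i) * norm (?g (n - i)))" for n
    unfolding prod norm_mult[symmetric] by (rule norm_sum)
  moreover have "summable (\<lambda>n. \<Sum>i\<le>n. norm (?f i) * norm (?g (n - i)))"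
    using assms by (intro summable_Cauchy_product) (auto simp: has_abs_value_def)
  ultimately have "summable (\<lambda>n. norm (fps_nth (f * g) n * r ^ n))"
    by (metis (no_types, lifting) real_norm_def abs_norm_cancel summable_comparison_test')
  moreover have "(\<lambda>n. \<Sum>i\<le>n. ?f i * ?g (n - i)) sums ((\<Sum>n. ?f n) * (\<Sum>n. ?g n))"
    using assms by (intro Cauchy_product_sums) (auto simp: has_abs_value_def)
  ultimately show ?thesis
    using assms unfolding has_abs_value_def prod by (simp add: sums_iff)
qed

lemma has_abs_value_cmult: "has_abs_value f r v \<Longrightarrow> has_abs_value (fps_const c * f) r (c * v)"
  by (intro has_abs_value_mult has_abs_value_const)

lemma has_abs_value_diff:
  assumes "has_abs_value f r v" "has_abs_value g r w"
  shows "has_abs_value (f - g) r (v - w)"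
  using has_abs_value_add[OF assms(1) has_abs_value_cmult[OF assms(2), of "-1"]]
  by (simp flip: fps_const_neg)

lemma has_abs_value_power: "has_abs_value f r v \<Longrightarrow> has_abs_value (f ^ n) r (v ^ n)"
  by (induction n) (auto intro: has_abs_value_mult has_abs_value_1)

lemma has_abs_value_sum:
  assumes "\<And>i. i \<in> A \<Longrightarrow> has_abs_value (f i) r (v i)"
  shows "has_abs_value (\<Sum>i\<in>A. f i) r (\<Sum>i\<in>A. v i)"
  using assms by (induction A rule: infinite_finite_induct)
    (auto intro: has_abs_value_0 has_abs_value_add)

text \<open>For fixed \<open>j\<close> the quotient \<open>a (n - j) / a n\<close> tends to 1, and
  by monotonicity it is at most 1. So \<open>norm (b j)\<close> dominates the terms, and Tannery's
  theorem exchanges limit and sum.\<close>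

lemma convolution_ratio_tendsto:
  fixes a b :: "nat \<Rightarrow> real"
  assumes pos: "\<And>n. a n > 0" and mono: "incseq a"
    and ratio: "(\<lambda>n. a n / a (Suc n)) \<longlonglongrightarrow> 1"
    and b: "summable (\<lambda>n. norm (b n))" "b sums s"
  shows "(\<lambda>n. (\<Sum>j\<le>n. b j * a (n - j)) / a n) \<longlonglongrightarrow> s"
proof -
  \<comment> \<open>Extending by 0 beyond \<open>n\<close> turns the finite sums into series over
    all \<open>j\<close>.\<close>
  define t where "t j n = (if j \<le> n then b j * (a (n - j) / a n) else 0)" for j n
  have nz [simp]: "a n \<noteq> 0" for n using pos[of n] by simp
  have shift: "(\<lambda>n. a n / a (n + j)) \<longlonglongrightarrow> 1" for j
  proof (induction j)
    case 0
    show ?case by simp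
  next
    case (Suc j)
    have "(\<lambda>n. a n / a (n + j) * (a (n + j) / a (Suc (n + j)))) \<longlonglongrightarrow> 1 * 1"
      by (intro tendsto_mult Suc LIMSEQ_ignore_initial_segment[OF ratio])
    moreover have "a n / a (n + j) * (a (n + j) / a (Suc (n + j))) = a n / a (n + Suc j)" for n
      by simp
    ultimately show ?case by simp
  qed
  have lim: "(\<lambda>n. t j n) \<longlonglongrightarrow> b j" for j
  proof -
    have "(\<lambda>n. b j * (a n / a (n + j))) \<longlonglongrightarrow> b j * 1"
      by (intro tendsto_mult tendsto_const shift)
    then have "(\<lambda>n. t j (n + j)) \<longlonglongrightarrow> b j" by (simp add: t_def)
    then show ?thesis by (rule LIMSEQ_offset)
  qed
  have bound: "norm (t j n) \<le> norm (b j)" for j n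
  proof (cases "j \<le> n")
    case True
    have "a (n - j) / a n \<le> 1"
      using incseqD[OF mono, of "n - j" n] pos[of n] by simp
    moreover have "a (n - j) / a n \<ge> 0"
      using pos by (intro divide_nonneg_nonneg) (auto intro: less_imp_le)
    ultimately have "\<bar>a (n - j) / a n\<bar> \<le> 1" by (simp only: abs_of_nonneg)
    then have "\<bar>b j\<bar> * \<bar>a (n - j) / a n\<bar> \<le> \<bar>b j\<bar> * 1"
      by (rule mult_left_mono) simp
    with True show ?thesis by (simp only: t_def abs_mult real_norm_def if_True mult_1_right)
  qed (simp add: t_def)
  have "(\<lambda>n. suminf (\<lambda>j. t j n)) \<longlonglongrightarrow> suminf b"
  proof -
    have "eventually (\<lambda>(k,n). norm (t k n) \<le> norm (b k)) (at_top \<times>\<^sub>F sequentially)"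
      using bound by (intro always_eventually) auto
    from tannerys_theorem[OF lim this b(1)] show ?thesis by simp
  qed
  moreover have "suminf (\<lambda>j. t j n) = (\<Sum>j\<le>n. b j * a (n - j)) / a n" for n
  proof -
    have "suminf (\<lambda>j. t j n) = (\<Sum>j\<le>n. t j n)"
      by (rule suminf_finite) (auto simp: t_def)
    also have "\<dots> = (\<Sum>j\<le>n. b j * a (n - j)) / a n"
      unfolding sum_divide_distrib by (rule sum.cong) (auto simp: t_def)
    finally show ?thesis .
  qed
  ultimately show ?thesis using b by (simp add: sums_iff)
qed

text \<open>The binomial series of \<open>(1 + c * x) powr a\<close>.\<close>

definition lin_binomial :: "real \<Rightarrow> real \<Rightarrow> real fps" where
  "lin_binomial a c = fps_binomial a oo (fps_const c * fps_X)"

lemma fps_nth_lin_binomial: "fps_nth (lin_binomial a c) n = c ^ n * (a gchoose n)"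
  by (simp add: lin_binomial_def)

lemma lin_binomial_add: "lin_binomial (a + b) c = lin_binomial a c * lin_binomial b c"
  by (simp add: lin_binomial_def fps_binomial_add_mult fps_compose_mult_distrib)

lemma lin_binomial_0: "lin_binomial 0 c = 1"
  by (simp add: lin_binomial_def)

lemma lin_binomial_1: "lin_binomial 1 c = 1 + fps_const c * fps_X"
  by (simp add: lin_binomial_def fps_binomial_1 fps_compose_add_distrib)

lemma lin_binomial_power: "lin_binomial a c ^ n = lin_binomial (real n * a) c"
  by (induction n) (auto simp: lin_binomial_0 lin_binomial_add distrib_right)

lemma lin_binomial_has_abs_value:
  assumes "\<bar>c * r\<bar> < 1"
  shows "has_abs_value (lin_binomial a c) r ((1 + c * r) powr a)"
proof -
  have eq: "fps_nth (lin_binomial a c) n * r ^ n = (a gchoose n) * (c * r) ^ n" for n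
    by (simp add: fps_nth_lin_binomial power_mult_distrib mult_ac)
  have "summable (\<lambda>n. norm ((a gchoose n) * (c * r) ^ n))"
    using assms by (intro abs_summable_in_conv_radius) (simp add: conv_radius_gchoose)
  then show ?thesis
    unfolding has_abs_value_def eq using gen_binomial_real[of "c * r" a] assms by simp
qed

text \<open>At the singularity itself: all coefficients of $(1-x)^{1/2}$ but the first are negative, and
  the partial sums of the series are the coefficients of $(1-x)^{-1/2}$, hence positive.\<close>

lemma summable_sqrt_binomial: "summable (\<lambda>n. norm (((1/2 :: real) gchoose n) * (-1) ^ n))"
proof -
  have pos: "(-1) ^ n * ((- a) gchoose n) > 0" if "a > 0" for a :: real and n
    using that by (simp add: gbinomial_pochhammer pochhammer_pos flip: power_mult_distrib mult.assoc)
  have neg: "((1/2 :: real) gchoose Suc n) * (-1) ^ Suc n < 0" for n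
  proof -
    have "real (Suc n) * (((1/2 :: real) gchoose Suc n) * (-1) ^ Suc n)
        = (real (Suc n) * ((1/2 :: real) gchoose Suc n)) * (-1) ^ Suc n"
      by (simp only: mult.assoc)
    also have "\<dots> = - (1/2 * ((-1) ^ n * ((- (1/2)) gchoose n)))"
      unfolding gbinomial_absorption by simp
    also have "\<dots> < 0" using pos[of "1/2" n] by simp
    finally show ?thesis by (simp only: mult_less_0_iff) auto
  qed
  have "summable (\<lambda>n. norm (((1/2 :: real) gchoose Suc n) * (-1) ^ Suc n))"
  proof (rule bounded_imp_summable[where B = 1])
    fix n
    have "(\<Sum>i\<le>n. norm (((1/2 :: real) gchoose Suc i) * (-1) ^ Suc i))
        = - (\<Sum>i\<le>n. ((1/2 :: real) gchoose Suc i) * (-1) ^ Suc i)"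
      unfolding sum_negf[symmetric] real_norm_def
      by (intro sum.cong refl abs_of_neg neg)
    also have "\<dots> = 1 - (\<Sum>i\<le>Suc n. ((1/2 :: real) gchoose i) * (-1) ^ i)"
      by (subst sum.atMost_Suc_shift) simp
    also have "\<dots> \<le> 1"
      using pos[of "1/2" "Suc n"] by (simp only: gbinomial_sum_lower_neg) simp
    finally show "(\<Sum>i\<le>n. norm (((1/2 :: real) gchoose Suc i) * (-1) ^ Suc i)) \<le> 1" .
  qed simp
  then show ?thesis by (subst (asm) summable_Suc_iff)
qed

section \<open>The dominant singularity and the transfer to coefficients\<close>

definition rho :: real where "rho = 3 - 2 * sqrt 2"

lemma rho_bounds: "0 < rho" "rho < 1"
proof -
  have "sqrt 2 < 3/2" by (rule real_less_lsqrt) (auto simp: power2_eq_square)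
  moreover have "1 < sqrt (2::real)" by simp
  ultimately show "0 < rho" "rho < 1" by (simp_all add: rho_def)
qed

lemma rho_power_cancel: "(- 1 / rho) ^ n * rho ^ n = (-1) ^ n"
  using rho_bounds by (simp flip: power_mult_distrib)

lemma rho_quadratic: "1 - 6 * rho + rho\<^sup>2 = 0"
  by (simp add: rho_def power2_eq_square algebra_simps)

text \<open>The series \<open>D\<close> of the overview. The roots of its square are
  \<open>rho\<close> and \<open>1 / rho\<close>, whence the two factors; only the first one is
  singular at \<open>rho\<close>.\<close>

definition sqrt_disc :: "real fps" where
  "sqrt_disc = lin_binomial (1/2) (- 1 / rho) * lin_binomial (1/2) (- rho)"

lemma sqrt_disc_squared: "sqrt_disc\<^sup>2 = 1 - 6 * fps_X + fps_X\<^sup>2"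
proof -
  have "sqrt_disc\<^sup>2 = lin_binomial 1 (- 1 / rho) * lin_binomial 1 (- rho)"
    unfolding sqrt_disc_def power_mult_distrib lin_binomial_power by simp
  also have "\<dots> = 1 + fps_const (- 1 / rho + (- rho)) * fps_X + fps_const (- 1 / rho * (- rho)) * fps_X\<^sup>2"
    unfolding lin_binomial_1 fps_const_add[symmetric] fps_const_mult[symmetric]
    by (simp add: algebra_simps power2_eq_square del: fps_const_neg fps_const_mult fps_const_add)
  also have "- 1 / rho + (- rho) = - 6"
    using rho_bounds rho_quadratic by (simp add: field_simps power2_eq_square)
  also have "- 1 / rho * (- rho) = 1" using rho_bounds by simp
  also have "fps_const (- 6 :: real) = - 6"
    by (simp add: numeral_fps_const)
  finally show ?thesis by simp
qed

lemma sqrt_disc_nth_0: "fps_nth sqrt_disc 0 = 1"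
  by (simp add: sqrt_disc_def fps_nth_lin_binomial)

text \<open>The singular factor converges absolutely at \<open>rho\<close> by
  \<open>summable_sqrt_binomial\<close>, so some value \<open>d\<close> exists. Squaring gives the
  quadratic at its root, hence \<open>d = 0\<close>.\<close>

lemma sqrt_disc_has_abs_value: "has_abs_value sqrt_disc rho 0"
proof -
  have "summable (\<lambda>n. norm (fps_nth (lin_binomial (1/2) (- 1 / rho)) n * rho ^ n))"
  proof -
    have "fps_nth (lin_binomial (1/2) (- 1 / rho)) n * rho ^ n = ((1/2) gchoose n) * (-1) ^ n" for n
      using rho_power_cancel[of n] by (simp add: fps_nth_lin_binomial mult_ac)
    then show ?thesis using summable_sqrt_binomial by simp
  qed
  then obtain v where "has_abs_value (lin_binomial (1/2) (- 1 / rho)) rho v"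
    by (rule has_abs_valueE)
  moreover have "rho * rho < 1"
    using rho_bounds mult_strict_mono[of rho 1 rho 1] by simp
  then have "\<bar>- rho * rho\<bar> < 1" using rho_bounds by simp
  ultimately obtain d where d: "has_abs_value sqrt_disc rho d"
    unfolding sqrt_disc_def by (blast intro: has_abs_value_mult lin_binomial_has_abs_value)
  have "has_abs_value (sqrt_disc\<^sup>2) rho (1 - 6 * rho + rho\<^sup>2)"
    unfolding sqrt_disc_squared
    by (intro has_abs_value_add has_abs_value_diff has_abs_value_1 has_abs_value_mult
        has_abs_value_numeral has_abs_value_X has_abs_value_power)
  then have "d\<^sup>2 = 0"
    using has_abs_value_power[OF d, of 2] has_abs_value_unique rho_quadratic by metis
  with d show ?thesis by simp
qed

text \<open>\<open>f\<close> is a series absolutely convergent at \<open>rho\<close> times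
  \<open>(1 - x / rho)\<close> to the power \<open>-m/2\<close>, and
  \<open>convolution_ratio_tendsto\<close> compares it with the coefficients of that power, which
  are nondecreasing up to the factor \<open>rho ^ n\<close> because \<open>m/2 \<ge> 1\<close>. As
  \<open>a\<close> and \<open>B\<close> do not depend on \<open>f\<close>, they cancel in
  quotients.\<close>

lemma transfer_sqrt_disc:
  assumes "m \<ge> 2"
  obtains a :: "nat \<Rightarrow> real" and B where "B \<noteq> 0" "\<And>n. a n \<noteq> 0"
    "\<And>f c. has_abs_value (sqrt_disc ^ m * f) rho c \<Longrightarrow>
       (\<lambda>n. fps_nth f n / a n) \<longlonglongrightarrow> B * c"
proof -
  define l where "l = real m / 2"
  \<comment> \<open>The coefficients of \<open>(1 - x)\<close> to the power \<open>-l\<close>;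
    \<open>B\<close> below is the value at \<open>rho\<close> of \<open>(1 - rho * x)\<close> to the
    same power.\<close>
  define \<alpha> where "\<alpha> n = (-1) ^ n * ((- l) gchoose n)" for n
  define B where "B = (1 + (- rho) * rho) powr (- l)"
  have l: "l \<ge> 1" using assms by (simp add: l_def)
  have r2: "rho * rho < 1"
    using rho_bounds mult_strict_mono[of rho 1 rho 1] by simp
  then have r2': "\<bar>- rho * rho\<bar> < 1" using rho_bounds by simp
  have \<alpha>_altdef: "\<alpha> n = pochhammer l n / fact n" for n
    by (simp add: \<alpha>_def gbinomial_pochhammer flip: power_mult_distrib mult.assoc)
  have \<alpha>_Suc: "\<alpha> (Suc n) = \<alpha> n * ((l + real n) / (1 + real n))" for n
    by (simp add: \<alpha>_altdef pochhammer_Suc field_simps)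
  have \<alpha>_pos: "\<alpha> n > 0" for n
    using l by (simp add: \<alpha>_altdef pochhammer_pos)
  have \<alpha>_mono: "incseq \<alpha>"
  proof (rule incseq_SucI)
    fix n
    have "1 \<le> (l + real n) / (1 + real n)" using l by simp
    then have "\<alpha> n * 1 \<le> \<alpha> n * ((l + real n) / (1 + real n))"
      using \<alpha>_pos[of n] by (intro mult_left_mono) auto
    then show "\<alpha> n \<le> \<alpha> (Suc n)" unfolding \<alpha>_Suc by simp
  qed
  have "\<alpha> n / \<alpha> (Suc n) = (1 + real n) / (l + real n)" for n
    unfolding \<alpha>_Suc using \<alpha>_pos[of n] by simp
  moreover have "(\<lambda>n. (1 + real n) / (l + real n)) \<longlonglongrightarrow> 1"
    by real_asymp
  ultimately have \<alpha>_ratio: "(\<lambda>n. \<alpha> n / \<alpha> (Suc n)) \<longlonglongrightarrow> 1" by simp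
  show thesis
  proof (rule that[of B "\<lambda>n. \<alpha> n / rho ^ n"])
    show "B \<noteq> 0" using r2 by (simp add: B_def)
    show "\<alpha> n / rho ^ n \<noteq> 0" for n using \<alpha>_pos[of n] rho_bounds by simp
    fix f c assume f: "has_abs_value (sqrt_disc ^ m * f) rho c"
    \<comment> \<open>This is \<open>(1 - x / rho)\<close> to the power \<open>l\<close>, times
      \<open>f\<close>, in a form that shows absolute convergence at \<open>rho\<close>.\<close>
    define g where "g = lin_binomial (- l) (- rho) * (sqrt_disc ^ m * f)"
    have g: "has_abs_value g rho (B * c)"
      unfolding g_def B_def using f r2' by (intro has_abs_value_mult lin_binomial_has_abs_value) auto
    have "lin_binomial (- l) (- 1 / rho) * g =
      (lin_binomial (- l) (- 1 / rho) * lin_binomial l (- 1 / rho)) *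
      (lin_binomial (- l) (- rho) * lin_binomial l (- rho)) * f"
      unfolding g_def sqrt_disc_def power_mult_distrib lin_binomial_power by (simp add: l_def mult_ac)
    also have "\<dots> = f"
      by (simp add: lin_binomial_0 flip: lin_binomial_add)
    finally have fg: "f = g * lin_binomial (- l) (- 1 / rho)" by (simp add: mult.commute)
    have "fps_nth f n / (\<alpha> n / rho ^ n) = (\<Sum>j\<le>n. (fps_nth g j * rho ^ j) * \<alpha> (n - j)) / \<alpha> n" for n
    proof -
      have "fps_nth f n * rho ^ n = (\<Sum>j\<le>n. (fps_nth g j * rho ^ j) * \<alpha> (n - j))"
        unfolding fg fps_mult_nth atLeast0AtMost sum_distrib_right
      proof (intro sum.cong refl)
        fix j assume "j \<in> {..n}"
        then have "rho ^ n = rho ^ j * rho ^ (n - j)" by (simp flip: power_add)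
        then show "fps_nth g j * fps_nth (lin_binomial (- l) (- 1 / rho)) (n - j) * rho ^ n =
            fps_nth g j * rho ^ j * \<alpha> (n - j)"
          using rho_power_cancel[of "n - j"] by (simp add: fps_nth_lin_binomial \<alpha>_def mult_ac)
      qed
      then show ?thesis using \<alpha>_pos[of n] by simp
    qed
    moreover have "(\<lambda>n. (\<Sum>j\<le>n. (fps_nth g j * rho ^ j) * \<alpha> (n - j)) / \<alpha> n) \<longlonglongrightarrow> B * c"
      using g by (intro convolution_ratio_tendsto \<alpha>_pos \<alpha>_mono \<alpha>_ratio) (auto simp: has_abs_value_def)
    ultimately show "(\<lambda>n. fps_nth f n / (\<alpha> n / rho ^ n)) \<longlonglongrightarrow> B * c" by (simp only:)
  qed
qed

section \<open>Signed binary trees\<close>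

lemma perms_iff: "\<pi> \<in> perms k \<longleftrightarrow> is_perm \<pi> \<and> length \<pi> = k"
  using length_perms[of \<pi> k] by (auto simp: is_perm_def)

lemma is_perm_skew_sum: "is_perm a \<Longrightarrow> is_perm b \<Longrightarrow> is_perm (skew_sum a b)"
  by (simp add: skew_sum_conv_dsum is_perm_rev is_perm_dsum)

lemma is_perm_perm_of_tree: "is_perm (perm_of_tree t)"
  by (induction t rule: perm_of_tree.induct)
    (simp_all add: is_perm_dsum is_perm_skew_sum, simp add: is_perm_iff)

fun flip :: "sign \<Rightarrow> sign" where
  "flip Plus = Minus"
| "flip Minus = Plus"

fun mirror_flip :: "sign tree \<Rightarrow> sign tree" where
  "mirror_flip Leaf = Leaf"
| "mirror_flip (Node l s r) = Node (mirror_flip r) (flip s) (mirror_flip l)"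

lemma mirror_flip_mirror_flip [simp]: "mirror_flip (mirror_flip t) = t"
proof -
  have "flip (flip s) = s" for s by (cases s) auto
  then show ?thesis by (induction t) auto
qed

text \<open>Since \<open>rev (dsum a b) = skew_sum (rev b) (rev a)\<close>, mirroring together with
  a change of all signs is reversal on the level of trees.\<close>

lemma perm_of_tree_mirror_flip: "perm_of_tree (mirror_flip t) = rev (perm_of_tree t)"
  by (induction t rule: perm_of_tree.induct) (simp_all add: skew_sum_conv_dsum)

definition proper_splits :: "nat list \<Rightarrow> (nat list \<times> nat list) set" where
  "proper_splits \<pi> = {(a, b) \<in> splits \<pi>. a \<noteq> [] \<and> b \<noteq> []}"

lemma finite_proper_splits [simp]: "finite (proper_splits \<pi>)"
  by (rule finite_subset[OF _ finite_splits[of \<pi>]]) (auto simp: proper_splits_def)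

lemma perm_of_tree_not_Nil [simp]: "perm_of_tree t \<noteq> []"
  using length_perm_of_tree[of t] by auto

text \<open>Pairs of subtrees are sorted by their two permutations; as these are nonempty, only
  proper splittings occur.\<close>

lemma card_tree_pairs:
  "card {(l, r). dsum (perm_of_tree l) (perm_of_tree r) = \<pi>} =
     (\<Sum>(a, b)\<in>proper_splits \<pi>. num_signed_trees a * num_signed_trees b)"
  "finite {(l, r). dsum (perm_of_tree l) (perm_of_tree r) = \<pi>}"
proof -
  define T where "T a = {t. perm_of_tree t = a}" for a
  have eq: "{(l, r). dsum (perm_of_tree l) (perm_of_tree r) = \<pi>} = (\<Union>(a, b)\<in>proper_splits \<pi>. T a \<times> T b)"
    by (auto simp: T_def proper_splits_def splits_def is_perm_perm_of_tree)
  have fin: "finite (T a)" for a using finite_signed_trees by (simp add: T_def)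
  have "\<forall>p\<in>proper_splits \<pi>. \<forall>q\<in>proper_splits \<pi>. p \<noteq> q \<longrightarrow>
      (case p of (a, b) \<Rightarrow> T a \<times> T b) \<inter> (case q of (a, b) \<Rightarrow> T a \<times> T b) = {}"
    by (auto simp: T_def)
  then show "card {(l, r). dsum (perm_of_tree l) (perm_of_tree r) = \<pi>} =
     (\<Sum>(a, b)\<in>proper_splits \<pi>. num_signed_trees a * num_signed_trees b)"
    unfolding eq using fin
    by (subst card_UN_disjoint) (auto simp: case_prod_unfold num_signed_trees_def T_def)
  show "finite {(l, r). dsum (perm_of_tree l) (perm_of_tree r) = \<pi>}"
    unfolding eq using fin by auto
qed

text \<open>The trees are classified by their root: a leaf, a sign \<open>Plus\<close>, or a sign
  \<open>Minus\<close>. The last class is carried to the second one by \<open>mirror_flip\<close>,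
  which reverses the pattern.\<close>

lemma num_signed_trees_rec:
  "num_signed_trees \<pi> = (if \<pi> = [1] then 1 else 0)
     + (\<Sum>(a, b)\<in>proper_splits \<pi>. num_signed_trees a * num_signed_trees b)
     + (\<Sum>(a, b)\<in>proper_splits (rev \<pi>). num_signed_trees a * num_signed_trees b)"
proof -
  define Q where "Q \<rho> = {(l, r). dsum (perm_of_tree l) (perm_of_tree r) = \<rho>}" for \<rho>
  define f where "f = (\<lambda>(l, r). Node l Plus r)"
  define g where "g = (\<lambda>(l, r). Node (mirror_flip r) Minus (mirror_flip l))"
  define L where "L = (if \<pi> = [1] then {Leaf :: sign tree} else {})"
  have mirror_inject: "mirror_flip s = mirror_flip t \<longleftrightarrow> s = t" for s t
    by (metis mirror_flip_mirror_flip)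
  have "t \<in> L \<union> f ` Q \<pi> \<union> g ` Q (rev \<pi>) \<longleftrightarrow> perm_of_tree t = \<pi>" for t
  proof (cases t rule: perm_of_tree.cases)
    case (3 l r)
    have "t \<in> g ` Q (rev \<pi>) \<longleftrightarrow> (mirror_flip r, mirror_flip l) \<in> Q (rev \<pi>)"
    proof
      assume "(mirror_flip r, mirror_flip l) \<in> Q (rev \<pi>)"
      then show "t \<in> g ` Q (rev \<pi>)" by (rule rev_image_eqI) (simp add: g_def 3)
    qed (auto simp: g_def 3)
    also have "\<dots> \<longleftrightarrow> perm_of_tree t = \<pi>"
      by (simp add: Q_def 3 skew_sum_conv_dsum perm_of_tree_mirror_flip rev_swap)
    finally show ?thesis by (auto simp: 3 L_def f_def)
  qed (auto simp: L_def Q_def f_def g_def)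
  then have "{t. perm_of_tree t = \<pi>} = L \<union> f ` Q \<pi> \<union> g ` Q (rev \<pi>)" by blast
  moreover have "finite (Q \<rho>)" for \<rho> unfolding Q_def by (rule card_tree_pairs)
  moreover have "finite L" "L \<inter> f ` Q \<pi> = {}" "(L \<union> f ` Q \<pi>) \<inter> g ` Q (rev \<pi>) = {}"
    by (auto simp: L_def f_def g_def)
  moreover have "inj f" "inj g" by (auto simp: inj_def f_def g_def mirror_inject)
  ultimately have "num_signed_trees \<pi> = card L + card (Q \<pi>) + card (Q (rev \<pi>))"
    unfolding num_signed_trees_def
    by (simp add: card_Un_disjoint card_image inj_on_subset[OF _ subset_UNIV])
  then show ?thesis unfolding Q_def card_tree_pairs by (simp add: L_def)
qed

section \<open>The number of all signed binary trees of a given size\<close>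

lemma sum_num_signed_trees:
  assumes "k \<ge> 1"
  shows "(\<Sum>\<pi>\<in>perms k. num_signed_trees \<pi>) = card {t :: sign tree. size t = k - 1}"
proof -
  \<comment> \<open>\<open>size\<close> counts internal vertices, one fewer than leaves, and each
    tree belongs to exactly one permutation.\<close>
  have "{t :: sign tree. size t = k - 1} = (\<Union>\<pi>\<in>perms k. {t. perm_of_tree t = \<pi>})"
    using assms by (auto simp: perms_iff is_perm_perm_of_tree length_perm_of_tree simp del: One_nat_def)
  also have "card \<dots> = (\<Sum>\<pi>\<in>perms k. card {t. perm_of_tree t = \<pi>})"
    by (rule card_UN_disjoint) (auto simp: finite_signed_trees)
  finally show ?thesis by (simp add: num_signed_trees_def)
qed

lemma catalan_Suc: "catalan (Suc n) * (real n + 2) = catalan n * (2 * (2 * real n + 1))"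
proof -
  have "Suc n * ((2 * Suc n) choose Suc n) = (2 * n + 2) * ((2 * n + 1) choose n)"
    using Suc_times_binomial[of n "2 * n + 1"] by simp
  moreover have "Suc n * ((2 * n + 1) choose n) = (2 * n + 1) * ((2 * n) choose n)"
    using Suc_times_binomial[of n "2 * n"] binomial_symmetric[of n "2 * n + 1"] by simp
  ultimately have "Suc n * (Suc n * ((2 * Suc n) choose Suc n)) = (2 * n + 2) * ((2 * n + 1) * ((2 * n) choose n))"
    by (metis mult.left_commute)
  \<comment> \<open>Cancels the common factor \<open>n + 1\<close>.\<close>
  moreover have "x = 2 * y" if "Suc n * x = (2 * n + 2) * y" for x y
  proof -
    have "Suc n * x = Suc n * (2 * y)" using that by (simp add: algebra_simps)
    then show ?thesis by (simp only: mult_cancel1) simp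
  qed
  ultimately have "Suc n * ((2 * Suc n) choose Suc n) = 2 * ((2 * n + 1) * ((2 * n) choose n))"
    by blast
  then have "real (Suc n * ((2 * Suc n) choose Suc n)) = real (2 * ((2 * n + 1) * ((2 * n) choose n)))"
    by (simp only:)
  then have "real (Suc n) * real ((2 * Suc n) choose Suc n) = 2 * (2 * real n + 1) * real ((2 * n) choose n)"
    by (simp only: of_nat_mult) (simp add: algebra_simps)
  then show ?thesis
    unfolding catalan_def by (simp add: field_simps del: binomial_Suc_Suc)
qed

text \<open>These are the coefficients of the square root of \<open>1 - 8 * x\<close>; both sides
  satisfy the recurrence \<open>catalan_Suc\<close>, up to the factor 2 per step.\<close>

lemma sqrt_binomial_catalan: "(- 8) ^ Suc n * ((1/2) gchoose Suc n) = - 4 * (2 ^ n * catalan n)"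
proof (induction n)
  case (Suc n)
  have "real (Suc (Suc n)) * ((- 8) ^ Suc (Suc n) * ((1/2) gchoose Suc (Suc n)))
      = (- 8) ^ Suc (Suc n) * ((1/2) * ((1/2) gchoose Suc n) - real (Suc n) * ((1/2) gchoose Suc n))"
  proof -
    have "real (Suc (Suc n)) * ((1/2) gchoose Suc (Suc n))
        = (1/2) * ((1/2) gchoose Suc n) - real (Suc n) * ((1/2) gchoose Suc n)"
      using gbinomial_mult_1[of "1/2 :: real" "Suc n"] by linarith
    then show ?thesis by (metis mult.left_commute)
  qed
  also have "\<dots> = 8 * (real n + 1/2) * ((- 8) ^ Suc n * ((1/2) gchoose Suc n))"
    by (simp add: algebra_simps)
  also have "\<dots> = - 4 * (2 ^ Suc n * (catalan n * (2 * (2 * real n + 1))))"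
    unfolding Suc by (simp add: algebra_simps)
  also have "\<dots> = real (Suc (Suc n)) * (- 4 * (2 ^ Suc n * catalan (Suc n)))"
    unfolding catalan_Suc[symmetric] by (simp add: algebra_simps)
  finally show ?case by (simp only: mult_cancel_left) auto
qed (simp add: catalan_def)

text \<open>Splitting at the root, with two choices of sign, gives
  \<open>X = 1 + 2 * x * X^2\<close> for the counting series. Hence \<open>1 - 4 * x * X\<close> is
  a square root of \<open>1 - 8 * x\<close>, and its constant term selects the branch.\<close>

lemma card_sign_trees: "real (card {t :: sign tree. size t = n}) = 2 ^ n * catalan n"
proof -
  define T where "T n = {t :: sign tree. size t = n}" for n
  define X where "X = Abs_fps (\<lambda>n. real (card (T n)))"
  have fin [simp]: "finite (T n)" for n
    unfolding T_def by (rule finite_subset[OF _ finite_trees_of_size[of n]]) auto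
  have T0: "T 0 = {Leaf}" by (auto simp: T_def)
  have "card (T (Suc n)) = 2 * (\<Sum>i\<le>n. card (T i) * card (T (n - i)))" for n
  proof -
    define Q where "Q = (\<Union>i\<le>n. T i \<times> T (n - i))"
    have cardQ: "card Q = (\<Sum>i\<le>n. card (T i) * card (T (n - i)))"
    proof -
      have "\<forall>i\<in>{..n}. \<forall>j\<in>{..n}. i \<noteq> j \<longrightarrow> (T i \<times> T (n - i)) \<inter> (T j \<times> T (n - j)) = {}"
        by (auto simp: T_def)
      then show ?thesis
        unfolding Q_def by (subst card_UN_disjoint) (auto simp: card_cartesian_product)
    qed
    have "T (Suc n) = (\<lambda>(s, l, r). Node l s r) ` (UNIV \<times> Q)"
    proof (intro equalityI subsetI)
      fix t assume "t \<in> T (Suc n)"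
      then obtain l s r where t: "t = Node l s r" "size l + size r = n"
        by (cases t) (auto simp: T_def)
      then have "(l, r) \<in> Q" by (auto simp: Q_def T_def)
      then show "t \<in> (\<lambda>(s, l, r). Node l s r) ` (UNIV \<times> Q)" by (force simp: t)
    qed (auto simp: Q_def T_def)
    moreover have "inj_on (\<lambda>(s, l, r). Node l s r) (UNIV \<times> Q)" by (auto simp: inj_on_def)
    ultimately have "card (T (Suc n)) = card (UNIV :: sign set) * card Q"
      by (simp add: card_image card_cartesian_product)
    moreover have "(UNIV :: sign set) = {Plus, Minus}" using sign.exhaust by auto
    then have "card (UNIV :: sign set) = 2" by (metis card_2_iff sign.distinct(1))
    ultimately show ?thesis by (simp add: cardQ)
  qed
  then have rec: "fps_nth X (Suc n) = 2 * fps_nth (X * X) n" for n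
    by (simp add: X_def fps_mult_nth atLeast0AtMost)
  have X: "X = 1 + 2 * fps_X * (X * X)"
  proof (rule fps_ext)
    fix n show "fps_nth X n = fps_nth (1 + 2 * fps_X * (X * X)) n"
      using rec[of "n - 1"] by (cases n) (simp_all add: X_def T0 mult.assoc numeral_fps_const)
  qed
  have "(1 - 4 * fps_X * X)\<^sup>2 = 1 - 8 * fps_X * (X - 2 * fps_X * (X * X))"
    by (simp add: power2_eq_square algebra_simps)
  also have "X - 2 * fps_X * (X * X) = 1" by (subst (1) X) simp
  also have "1 - 8 * fps_X * (1 :: real fps) = (lin_binomial (1/2) (- 8))\<^sup>2"
    unfolding lin_binomial_power by (simp add: lin_binomial_1 numeral_fps_const)
  finally have "1 - 4 * fps_X * X = lin_binomial (1/2) (- 8) \<or> 1 - 4 * fps_X * X = - lin_binomial (1/2) (- 8)"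
    by (simp only: power2_eq_iff)
  moreover have "1 - 4 * fps_X * X \<noteq> - lin_binomial (1/2) (- 8)"
  proof
    assume "1 - 4 * fps_X * X = - lin_binomial (1/2) (- 8)"
    then have "fps_nth (1 - 4 * fps_X * X) 0 = fps_nth (- lin_binomial (1/2) (- 8)) 0" by (simp only:)
    then show False by (simp add: fps_nth_lin_binomial)
  qed
  ultimately have "fps_nth (1 - 4 * fps_X * X) (Suc n) = fps_nth (lin_binomial (1/2) (- 8)) (Suc n)" by simp
  then have "- 4 * fps_nth X n = (- 8) ^ Suc n * ((1/2) gchoose Suc n)"
    by (simp add: fps_nth_lin_binomial mult.assoc numeral_fps_const)
  then show ?thesis unfolding sqrt_binomial_catalan by (simp add: X_def T_def)
qed

section \<open>Generating functions of occurrences\<close>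

text \<open>The empty pattern occurs exactly once in every list, so \<open>occ_gf C []\<close> is
  the plain counting series of \<open>C\<close>.\<close>

definition occ_gf :: "nat list set \<Rightarrow> nat list \<Rightarrow> real fps" where
  "occ_gf C \<pi> = Abs_fps (\<lambda>n. \<Sum>\<sigma> | \<sigma> \<in> C \<and> length \<sigma> = n. real (card (occs \<pi> \<sigma>)))"

lemma finite_separable_length:
  assumes "C \<subseteq> separables"
  shows "finite {\<sigma> \<in> C. length \<sigma> = n}"
  by (rule finite_subset[OF _ finite_separable_perms[of n]]) (use assms in \<open>auto simp: separables_def\<close>)

lemma occ_gf_Un:
  assumes "C \<subseteq> separables" "C' \<subseteq> separables" "C \<inter> C' = {}"
  shows "occ_gf (C \<union> C') \<pi> = occ_gf C \<pi> + occ_gf C' \<pi>"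
proof (rule fps_ext)
  fix n
  have "{\<sigma> \<in> C \<union> C'. length \<sigma> = n} = {\<sigma> \<in> C. length \<sigma> = n} \<union> {\<sigma> \<in> C'. length \<sigma> = n}" by auto
  then show "fps_nth (occ_gf (C \<union> C') \<pi>) n = fps_nth (occ_gf C \<pi> + occ_gf C' \<pi>) n"
    using assms finite_separable_length[of C n] finite_separable_length[of C' n]
    by (simp add: occ_gf_def) (subst sum.union_disjoint, auto)
qed

lemma occ_gf_rev: "occ_gf (rev ` C) \<pi> = occ_gf C (rev \<pi>)"
proof (rule fps_ext)
  fix n
  have "{\<sigma> \<in> rev ` C. length \<sigma> = n} = rev ` {\<sigma> \<in> C. length \<sigma> = n}" by auto
  moreover have "card (occs \<pi> (rev \<sigma>)) = card (occs (rev \<pi>) \<sigma>)" for \<sigma>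
    using card_occs_rev[of "rev \<pi>" \<sigma>] by simp
  ultimately show "fps_nth (occ_gf (rev ` C) \<pi>) n = fps_nth (occ_gf C (rev \<pi>)) n"
    by (simp add: occ_gf_def sum.reindex)
qed

lemma occ_gf_separable_rev: "occ_gf separables (rev \<pi>) = occ_gf separables \<pi>"
proof -
  have "rev ` separables = separables" using rev_separable_iff by (metis image_iff rev_rev_ident subsetI subset_antisym)
  then show ?thesis using occ_gf_rev[of separables \<pi>] by simp
qed

lemma occ_gf_indecomposable: "occ_gf sum_indecomposables \<pi> = occ_gf separables \<pi> - occ_gf sum_decomposables \<pi>"
proof -
  have "separables = sum_decomposables \<union> sum_indecomposables" using decomposable_subset by (auto simp: sum_indecomposables_def)
  then have "occ_gf separables \<pi> = occ_gf sum_decomposables \<pi> + occ_gf sum_indecomposables \<pi>"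
    using occ_gf_Un[of sum_decomposables sum_indecomposables \<pi>] decomposable_subset by (auto simp: sum_indecomposables_def)
  then show ?thesis by simp
qed

lemma occ_gf_single: "occ_gf {[1]} \<pi> = (if \<pi> = [] \<or> \<pi> = [1] then fps_X else 0)"
proof -
  have "occs \<pi> [1] = (if \<pi> = [] then {[]} else if \<pi> = [1] then {[1]} else {})"
  proof -
    have "{s. subseq s [1 :: nat]} = {[], [1]}"
      unfolding set_subseqs_eq[symmetric] by auto
    then have "occs \<pi> [1] = {s \<in> {[], [1]}. standardize s = \<pi>}" unfolding occs_def by blast
    moreover have std: "standardize [] = []" "standardize [1] = [1]"
      by (rule standardize_perm, simp add: is_perm_iff)+
    have "{s \<in> {[], [1]}. standardize s = \<pi>} = (if \<pi> = [] then {[]} else if \<pi> = [1] then {[1]} else {})"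
    proof (rule set_eqI)
      fix s :: "nat list"
      consider "s = []" | "s = [1]" | "s \<notin> {[], [1]}" by blast
      then show "s \<in> {s \<in> {[], [1]}. standardize s = \<pi>} \<longleftrightarrow>
          s \<in> (if \<pi> = [] then {[]} else if \<pi> = [1] then {[1]} else {})"
        by cases (use std in auto)
    qed
    ultimately show ?thesis by (simp only:)
  qed
  moreover have "{\<sigma>. \<sigma> = [1 :: nat] \<and> length \<sigma> = n} = (if n = 1 then {[1]} else {})" for n by auto
  ultimately show ?thesis
    by (intro fps_ext) (auto simp: occ_gf_def fps_X_def)
qed

text \<open>Skew sums enter as reversed direct sums, and the reversal is moved onto the
  pattern.\<close>

lemma occ_gf_separable: "occ_gf separables \<pi> = (if \<pi> = [] \<or> \<pi> = [1] then fps_X else 0) + occ_gf sum_decomposables \<pi> + occ_gf sum_decomposables (rev \<pi>)"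
proof -
  have sub: "{[1]} \<subseteq> separables" "sum_decomposables \<subseteq> separables" "rev ` sum_decomposables \<subseteq> separables" "{[1]} \<union> sum_decomposables \<subseteq> separables"
    using separable_decomp by auto
  have "occ_gf separables \<pi> = occ_gf ({[1]} \<union> sum_decomposables) \<pi> + occ_gf (rev ` sum_decomposables) \<pi>"
    by (subst separable_decomp, rule occ_gf_Un) (use sub separable_decomp_disjoint in auto)
  also have "occ_gf ({[1]} \<union> sum_decomposables) \<pi> = occ_gf {[1]} \<pi> + occ_gf sum_decomposables \<pi>"
    by (rule occ_gf_Un) (use sub separable_decomp_disjoint in auto)
  finally show ?thesis unfolding occ_gf_rev occ_gf_single .
qed

lemma occ_gf_mult_nth:
  assumes "C \<subseteq> separables" "C' \<subseteq> separables"
  shows "fps_nth (occ_gf C a * occ_gf C' b) n =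
    (\<Sum>(\<sigma>, \<tau>) | \<sigma> \<in> C \<and> \<tau> \<in> C' \<and> length \<sigma> + length \<tau> = n. real (card (occs a \<sigma>) * card (occs b \<tau>)))"
proof -
  define L where "L D i = {\<sigma> \<in> D. length \<sigma> = i}" for D :: "nat list set" and i
  have fin: "finite (L C i)" "finite (L C' i)" for i
    using assms finite_separable_length by (auto simp: L_def)
  have "fps_nth (occ_gf C a * occ_gf C' b) n =
      (\<Sum>i\<le>n. \<Sum>(\<sigma>, \<tau>)\<in>L C i \<times> L C' (n - i). real (card (occs a \<sigma>) * card (occs b \<tau>)))"
    by (simp add: fps_mult_nth occ_gf_def atLeast0AtMost sum_product sum.cartesian_product L_def)
  also have "\<dots> = (\<Sum>(\<sigma>, \<tau>)\<in>(\<Union>i\<le>n. L C i \<times> L C' (n - i)). real (card (occs a \<sigma>) * card (occs b \<tau>)))"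
    using fin by (intro sum.UNION_disjoint[symmetric]) (auto simp: L_def)
  also have "(\<Union>i\<le>n. L C i \<times> L C' (n - i)) = {(\<sigma>, \<tau>). \<sigma> \<in> C \<and> \<tau> \<in> C' \<and> length \<sigma> + length \<tau> = n}"
    by (auto simp: L_def)
  finally show ?thesis by simp
qed

text \<open>The unique decomposition \<open>bij_betw_dsum\<close> turns sums over direct sums into
  Cauchy products, and \<open>card_occs_dsum\<close> distributes the occurrences over the
  factors.\<close>

lemma occ_gf_decomposable: "occ_gf sum_decomposables \<pi> = (\<Sum>(a, b)\<in>splits \<pi>. occ_gf separables a * occ_gf sum_indecomposables b)"
proof (rule fps_ext)
  fix n
  define Q where "Q = {(\<sigma>, \<tau>). \<sigma> \<in> separables \<and> \<tau> \<in> sum_indecomposables \<and> length \<sigma> + length \<tau> = n}"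
  have "bij_betw (\<lambda>(a, b). dsum a b) Q {\<sigma> \<in> sum_decomposables. length \<sigma> = n}"
  proof (rule bij_betw_subset[OF bij_betw_dsum])
    have "(\<lambda>(a, b). dsum a b) ` Q = {\<sigma> \<in> (\<lambda>(a, b). dsum a b) ` (separables \<times> sum_indecomposables). length \<sigma> = n}"
      by (auto simp: Q_def)
    then show "(\<lambda>(a, b). dsum a b) ` Q = {\<sigma> \<in> sum_decomposables. length \<sigma> = n}"
      using bij_betw_dsum by (simp add: bij_betw_def)
  qed (auto simp: Q_def)
  then have "fps_nth (occ_gf sum_decomposables \<pi>) n = (\<Sum>(\<sigma>, \<tau>)\<in>Q. real (card (occs \<pi> (dsum \<sigma> \<tau>))))"
    by (simp add: occ_gf_def case_prod_unfold flip: sum.reindex_bij_betw)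
  also have "\<dots> = (\<Sum>(\<sigma>, \<tau>)\<in>Q. \<Sum>(a, b)\<in>splits \<pi>. real (card (occs a \<sigma>) * card (occs b \<tau>)))"
    by (rule sum.cong) (auto simp: Q_def sum_indecomposables_def card_occs_dsum separable_is_perm case_prod_unfold)
  also have "\<dots> = (\<Sum>(a, b)\<in>splits \<pi>. \<Sum>(\<sigma>, \<tau>)\<in>Q. real (card (occs a \<sigma>) * card (occs b \<tau>)))"
    unfolding case_prod_unfold by (rule sum.swap)
  also have "\<dots> = (\<Sum>(a, b)\<in>splits \<pi>. fps_nth (occ_gf separables a * occ_gf sum_indecomposables b) n)"
    by (subst occ_gf_mult_nth) (auto simp: Q_def sum_indecomposables_def)
  also have "\<dots> = fps_nth (\<Sum>(a, b)\<in>splits \<pi>. occ_gf separables a * occ_gf sum_indecomposables b) n"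
    by (simp add: fps_sum_nth case_prod_unfold)
  finally show "fps_nth (occ_gf sum_decomposables \<pi>) n = fps_nth (\<Sum>(a, b)\<in>splits \<pi>. occ_gf separables a * occ_gf sum_indecomposables b) n" .
qed

text \<open>The terms whose two patterns are both strictly shorter; in the recursion they are
  already known.\<close>

definition split_gf :: "nat list \<Rightarrow> real fps" where
  "split_gf \<pi> = (\<Sum>(a, b)\<in>proper_splits \<pi>. occ_gf separables a * occ_gf sum_indecomposables b)"

lemma occ_gf_decomposable_Nil: "occ_gf sum_decomposables [] = occ_gf separables [] * occ_gf sum_indecomposables []"
proof -
  have "splits [] = {([], [])}" by (auto simp: splits_def dsum_def is_perm_iff)
  then show ?thesis by (simp add: occ_gf_decomposable)
qed

lemma occ_gf_decomposable_perm:
  assumes "is_perm \<pi>" "\<pi> \<noteq> []"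
  shows "occ_gf sum_decomposables \<pi> = occ_gf separables [] * occ_gf sum_indecomposables \<pi> + occ_gf separables \<pi> * occ_gf sum_indecomposables [] + split_gf \<pi>"
proof -
  have "is_perm []" by (simp add: is_perm_iff)
  then have "splits \<pi> = insert ([], \<pi>) (insert (\<pi>, []) (proper_splits \<pi>))"
    using assms(1) by (auto simp: splits_def proper_splits_def)
  moreover have "([], \<pi>) \<noteq> (\<pi>, [])" "([], \<pi>) \<notin> proper_splits \<pi>" "(\<pi>, []) \<notin> proper_splits \<pi>"
    using assms(2) by (auto simp: proper_splits_def)
  ultimately show ?thesis by (simp add: occ_gf_decomposable split_gf_def)
qed

lemma occ_gf_separable_Nil: "occ_gf separables [] = fps_const (1/2) * (1 - fps_X - sqrt_disc)"
proof -
  define S where "S = occ_gf separables []"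
  define P where "P = occ_gf sum_decomposables []"
  have S: "S = fps_X + P + P" unfolding S_def P_def by (subst occ_gf_separable) simp
  have P: "P = S * (S - P)" using occ_gf_decomposable_Nil by (simp add: S_def P_def occ_gf_indecomposable)
  have "S - fps_X = 2 * P" using S by simp
  also have "\<dots> = S * (2 * S - 2 * P)" by (subst P) (simp add: algebra_simps)
  also have "\<dots> = S * (S + fps_X)" using S by (simp add: algebra_simps)
  finally have quad: "S = fps_X + S * (S + fps_X)" by (simp add: algebra_simps)
  have "(1 - fps_X - 2 * S)\<^sup>2 = (1 - fps_X)\<^sup>2 - 4 * (S - S * (S + fps_X))"
    by (simp add: power2_eq_square algebra_simps)
  also have "S - S * (S + fps_X) = fps_X" using quad by (simp add: algebra_simps)
  also have "(1 - fps_X)\<^sup>2 - 4 * fps_X = sqrt_disc\<^sup>2"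
    unfolding sqrt_disc_squared by (simp add: power2_eq_square algebra_simps)
  finally have "1 - fps_X - 2 * S = sqrt_disc \<or> 1 - fps_X - 2 * S = - sqrt_disc"
    by (simp only: power2_eq_iff)
  moreover have "1 - fps_X - 2 * S \<noteq> - sqrt_disc"
  proof
    assume "1 - fps_X - 2 * S = - sqrt_disc"
    then have "fps_nth (1 - fps_X - 2 * S) 0 = fps_nth (- sqrt_disc) 0" by (simp only:)
    moreover have "{\<sigma>. \<sigma> \<in> separables \<and> \<sigma> = []} = {}" using separable_not_Nil by auto
    then have "fps_nth S 0 = 0" by (simp add: S_def occ_gf_def)
    ultimately show False by (simp add: sqrt_disc_nth_0 numeral_fps_const)
  qed
  ultimately have "2 * S = 1 - fps_X - sqrt_disc" by (metis diff_diff_eq2 diff_add_cancel add_diff_cancel_left')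
  then have "fps_const (1/2) * (2 * S) = fps_const (1/2) * (1 - fps_X - sqrt_disc)" by simp
  moreover have "fps_const (1/2) * (2 * S) = S"
    by (simp add: numeral_fps_const mult.assoc[symmetric])
  ultimately show ?thesis by (simp add: S_def)
qed

text \<open>A linear system for \<open>F\<close>, \<open>G\<close>, \<open>G'\<close>, the series of
  all separable permutations and of direct sums for the pattern and its reversal, is solved in terms
  of the shorter patterns.\<close>

lemma occ_gf_equations:
  assumes "is_perm \<pi>" "\<pi> \<noteq> []"
  shows "sqrt_disc * occ_gf separables \<pi> = split_gf \<pi> + split_gf (rev \<pi>)
           + (if \<pi> = [1] then fps_X * (1 + occ_gf separables []) else 0)" (is ?thesis1)
    and "8 * occ_gf sum_indecomposables \<pi> = (occ_gf separables \<pi> * (2 - fps_X - occ_gf separables []) - 2 * split_gf \<pi>) * (3 - fps_X + sqrt_disc)" (is ?thesis2)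
proof -
  define S where "S = occ_gf separables []"
  define P where "P = occ_gf sum_decomposables []"
  define F where "F = occ_gf separables \<pi>"
  define G where "G = occ_gf sum_decomposables \<pi>"
  define G' where "G' = occ_gf sum_decomposables (rev \<pi>)"
  define A where "A = split_gf \<pi>"
  define A' where "A' = split_gf (rev \<pi>)"
  define E where "E = (if \<pi> = [1] then fps_X else 0 :: real fps)"
  have S2: "2 * S = 1 - fps_X - sqrt_disc"
    by (simp add: S_def occ_gf_separable_Nil numeral_fps_const mult.assoc[symmetric])
  have D: "sqrt_disc * sqrt_disc = 1 - 6 * fps_X + fps_X * fps_X"
    using sqrt_disc_squared by (simp add: power2_eq_square)
  have S: "S = fps_X + 2 * P" unfolding S_def P_def by (subst occ_gf_separable) simp
  have F: "F = E + G + G'" using assms(2) by (simp add: F_def occ_gf_separable E_def G_def G'_def)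
  have G: "G = S * (F - G) + F * (S - P) + A"
    using occ_gf_decomposable_perm[OF assms] by (simp add: F_def G_def S_def P_def A_def occ_gf_indecomposable)
  have G': "G' = S * (F - G') + F * (S - P) + A'"
    using occ_gf_decomposable_perm[of "rev \<pi>"] assms
    by (simp add: F_def G'_def S_def P_def A'_def occ_gf_indecomposable occ_gf_separable_rev is_perm_rev)
  \<comment> \<open>Adding the equations for \<open>G\<close> and \<open>G'\<close> leaves
    \<open>F\<close> with the factor \<open>1 - 2 * S - x\<close>, which is
    \<open>sqrt_disc\<close>.\<close>
  have "sqrt_disc * F = A + A' + E * (1 + S)"
    using S2 S F G G' by algebra
  then show ?thesis1 by (auto simp: F_def A_def A'_def E_def S_def)
  \<comment> \<open>The equation for \<open>G\<close> determines \<open>(1 + S) * (F - G)\<close>.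
    Instead of dividing, one multiplies by the conjugate of \<open>2 * (1 + S) = 3 - x - D\<close>,
    using \<open>(3 - x)^2 - D^2 = 8\<close>.\<close>
  have "8 * (F - G) = (F * (2 - fps_X - S) - 2 * A) * (3 - fps_X + sqrt_disc)"
    using S2 S G D by algebra
  then show ?thesis2 by (simp add: occ_gf_indecomposable F_def G_def A_def S_def)
qed


text \<open>The \<open>q\<close> of the overview, chosen so that \<open>2 * growth\<close> is the
  value at \<open>rho\<close> of the inhomogeneous term for the pattern \<open>[1]\<close>.\<close>

definition growth :: real where "growth = rho * (3 - rho) / 4"

lemma rho_3: "(3 - rho)\<^sup>2 = 8"
  using rho_quadratic by (simp add: power2_eq_square algebra_simps)

lemma occ_gf_separable_Nil_value: "has_abs_value (occ_gf separables []) rho ((1 - rho) / 2)"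
proof -
  have "has_abs_value (occ_gf separables []) rho (1/2 * (1 - rho - 0))"
    unfolding occ_gf_separable_Nil
    by (intro has_abs_value_mult has_abs_value_const has_abs_value_diff has_abs_value_1
        has_abs_value_X sqrt_disc_has_abs_value)
  then show ?thesis by simp
qed

text \<open>Induction along \<open>occ_gf_equations\<close>: at \<open>rho\<close> the first
  equation becomes the recursion \<open>num_signed_trees_rec\<close>, scaled by
  \<open>2 * growth ^ k\<close>. The indecomposable series gets exactly half of the value, which is
  why both claims are proved together.\<close>

lemma occ_gf_values:
  assumes "is_perm \<pi>" "\<pi> \<noteq> []"
  shows "has_abs_value (sqrt_disc ^ (2 * length \<pi> - 1) * occ_gf separables \<pi>) rho
           (2 * real (num_signed_trees \<pi>) * growth ^ length \<pi>) \<and>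
         has_abs_value (sqrt_disc ^ (2 * length \<pi> - 1) * occ_gf sum_indecomposables \<pi>) rho
           (real (num_signed_trees \<pi>) * growth ^ length \<pi>)"
  using assms
proof (induction "length \<pi>" arbitrary: \<pi> rule: less_induct)
  case less
  define k where "k = length \<pi>"
  define N where "N \<rho> = (\<Sum>(a, b)\<in>proper_splits \<rho>. real (num_signed_trees a) * real (num_signed_trees b))" for \<rho>
  have k: "k \<ge> 1" using less.prems by (cases \<pi>) (auto simp: k_def)
  have split: "has_abs_value (sqrt_disc ^ (2 * k - 2) * split_gf \<rho>) rho (2 * N \<rho> * growth ^ k)"
    if len: "length \<rho> = k" for \<rho>
  proof -
    have summand: "has_abs_value (sqrt_disc ^ (2 * k - 2) * (occ_gf separables a * occ_gf sum_indecomposables b)) rho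
        (2 * (real (num_signed_trees a) * real (num_signed_trees b)) * growth ^ k)"
      if "(a, b) \<in> proper_splits \<rho>" for a b
    proof -
      have ab: "is_perm a" "is_perm b" "a \<noteq> []" "b \<noteq> []" "k = length a + length b"
        using that len by (auto simp: proper_splits_def splits_def)
      then have pos: "length a \<ge> 1" "length b \<ge> 1" by (auto simp: Suc_le_eq)
      \<comment> \<open>The exponents of the two parts add up to one less than
        \<open>2 * k - 1\<close>; the missing factor is the \<open>sqrt_disc\<close> on the left of
        the first equation. Nonemptiness keeps the truncated subtractions exact.\<close>
      then have "2 * k - 2 = (2 * length a - 1) + (2 * length b - 1)" using ab(5) by linarith
      then have "sqrt_disc ^ (2 * k - 2) * (occ_gf separables a * occ_gf sum_indecomposables b)
          = (sqrt_disc ^ (2 * length a - 1) * occ_gf separables a) * (sqrt_disc ^ (2 * length b - 1) * occ_gf sum_indecomposables b)"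
        by (simp add: power_add mult_ac)
      moreover have "length a < length \<pi>" "length b < length \<pi>" using ab(5) pos by (auto simp: k_def)
      then have "has_abs_value ((sqrt_disc ^ (2 * length a - 1) * occ_gf separables a) * (sqrt_disc ^ (2 * length b - 1) * occ_gf sum_indecomposables b)) rho
          (2 * real (num_signed_trees a) * growth ^ length a * (real (num_signed_trees b) * growth ^ length b))"
        using less.hyps[of a] less.hyps[of b] ab by (intro has_abs_value_mult[of "_ * _" _ _ "_ * _"]) blast+
      moreover have "2 * (real (num_signed_trees a) * real (num_signed_trees b)) * growth ^ k
          = 2 * real (num_signed_trees a) * growth ^ length a * (real (num_signed_trees b) * growth ^ length b)"
        unfolding ab(5) by (simp add: power_add mult_ac)
      ultimately show ?thesis by (simp only:)
    qed
    have "has_abs_value (\<Sum>p\<in>proper_splits \<rho>. sqrt_disc ^ (2 * k - 2) * (occ_gf separables (fst p) * occ_gf sum_indecomposables (snd p))) rho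
      (\<Sum>p\<in>proper_splits \<rho>. 2 * (real (num_signed_trees (fst p)) * real (num_signed_trees (snd p))) * growth ^ k)"
      by (rule has_abs_value_sum) (use summand in auto)
    then show ?thesis
      by (simp add: split_gf_def N_def case_prod_unfold sum_distrib_left sum_distrib_right)
  qed
  have rec: "real (num_signed_trees \<pi>) = (if \<pi> = [1] then 1 else 0) + N \<pi> + N (rev \<pi>)"
    by (subst num_signed_trees_rec) (simp add: N_def case_prod_unfold)
  have sqrt_disc_Suc: "sqrt_disc ^ (2 * k - 1) = sqrt_disc * sqrt_disc ^ (2 * k - 2)"
    using k by (simp flip: power_Suc add: Suc_diff_Suc numeral_2_eq_2)
  have single: "has_abs_value (sqrt_disc ^ (2 * k - 2) * (if \<pi> = [1] then fps_X * (1 + occ_gf separables []) else 0)) rho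
      (2 * (if \<pi> = [1] then 1 else 0) * growth ^ k)"
  proof (cases "\<pi> = [1]")
    case True
    have "has_abs_value (fps_X * (1 + occ_gf separables [])) rho (rho * (1 + (1 - rho) / 2))"
      by (intro has_abs_value_mult has_abs_value_add has_abs_value_1 has_abs_value_X occ_gf_separable_Nil_value)
    moreover have "rho * (1 + (1 - rho) / 2) = 2 * growth" by (simp add: growth_def field_simps)
    ultimately show ?thesis using True by (simp add: k_def)
  qed (simp add: has_abs_value_0)
  have "sqrt_disc ^ (2 * k - 1) * occ_gf separables \<pi> = sqrt_disc ^ (2 * k - 2) * (sqrt_disc * occ_gf separables \<pi>)"
    unfolding sqrt_disc_Suc by (simp only: mult_ac)
  also have "\<dots> = sqrt_disc ^ (2 * k - 2) * split_gf \<pi> + sqrt_disc ^ (2 * k - 2) * split_gf (rev \<pi>)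
      + sqrt_disc ^ (2 * k - 2) * (if \<pi> = [1] then fps_X * (1 + occ_gf separables []) else 0)"
    unfolding occ_gf_equations(1)[OF less.prems] by (simp only: distrib_left)
  finally have eq: "sqrt_disc ^ (2 * k - 1) * occ_gf separables \<pi> = \<dots>" .
  have "has_abs_value (sqrt_disc ^ (2 * k - 1) * occ_gf separables \<pi>) rho
      (2 * N \<pi> * growth ^ k + 2 * N (rev \<pi>) * growth ^ k + 2 * (if \<pi> = [1] then 1 else 0) * growth ^ k)"
    unfolding eq by (intro has_abs_value_add split single) (simp_all add: k_def)
  also have "2 * N \<pi> * growth ^ k + 2 * N (rev \<pi>) * growth ^ k + 2 * (if \<pi> = [1] then 1 else 0) * growth ^ k
      = 2 * real (num_signed_trees \<pi>) * growth ^ k"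
    unfolding rec by (simp add: algebra_simps)
  finally have F: "has_abs_value (sqrt_disc ^ (2 * k - 1) * occ_gf separables \<pi>) rho (2 * real (num_signed_trees \<pi>) * growth ^ k)" .
  have "fps_const (1/8) * (8 * occ_gf sum_indecomposables \<pi>) = occ_gf sum_indecomposables \<pi>"
    by (simp add: numeral_fps_const mult.assoc[symmetric])
  then have "sqrt_disc ^ (2 * k - 1) * occ_gf sum_indecomposables \<pi> = fps_const (1/8) * (sqrt_disc ^ (2 * k - 1) * (8 * occ_gf sum_indecomposables \<pi>))"
    by (metis mult.left_commute)
  also have "\<dots> = fps_const (1/8) *
      (((sqrt_disc ^ (2 * k - 1) * occ_gf separables \<pi>) * (2 - fps_X - occ_gf separables []) - 2 * (sqrt_disc * (sqrt_disc ^ (2 * k - 2) * split_gf \<pi>)))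
        * (3 - fps_X + sqrt_disc))"
    unfolding occ_gf_equations(2)[OF less.prems] sqrt_disc_Suc by (simp add: algebra_simps)
  finally have eq: "sqrt_disc ^ (2 * k - 1) * occ_gf sum_indecomposables \<pi> = \<dots>" .
  \<comment> \<open>Here the split term carries an additional factor \<open>sqrt_disc\<close>, so it
    contributes 0 at \<open>rho\<close>.\<close>
  have "has_abs_value (sqrt_disc ^ (2 * k - 1) * occ_gf sum_indecomposables \<pi>) rho
      (1/8 * ((2 * real (num_signed_trees \<pi>) * growth ^ k * (2 - rho - (1 - rho) / 2)
         - 2 * (0 * (2 * N \<pi> * growth ^ k))) * (3 - rho + 0)))"
    unfolding eq
    by (intro has_abs_value_mult has_abs_value_diff has_abs_value_add has_abs_value_const
        has_abs_value_numeral has_abs_value_X occ_gf_separable_Nil_value sqrt_disc_has_abs_value F split) (simp add: k_def)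
  also have "1/8 * ((2 * real (num_signed_trees \<pi>) * growth ^ k * (2 - rho - (1 - rho) / 2)
         - 2 * (0 * (2 * N \<pi> * growth ^ k))) * (3 - rho + 0))
      = real (num_signed_trees \<pi>) * growth ^ k * ((3 - rho)\<^sup>2 / 8)"
    by (simp add: power2_eq_square field_simps)
  finally have "has_abs_value (sqrt_disc ^ (2 * k - 1) * occ_gf sum_indecomposables \<pi>) rho (real (num_signed_trees \<pi>) * growth ^ k)"
    by (simp add: rho_3)
  with F show ?case by (simp_all add: k_def)
qed

section \<open>Expected densities as quotients of coefficients\<close>

lemma sum_occ_set:
  assumes "\<sigma> \<in> perms n"
  shows "(\<Sum>\<pi>\<in>perms k. card (occ_set \<pi> \<sigma>)) = n choose k"
proof -
  have len: "length \<sigma> = n" using assms by (rule length_perms)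
  \<comment> \<open>Each set of \<open>k\<close> positions is an occurrence of exactly one pattern
    of size \<open>k\<close>.\<close>
  have "{I. I \<subseteq> {1..n} \<and> card I = k} = (\<Union>\<pi>\<in>perms k. occ_set \<pi> \<sigma>)"
  proof (intro equalityI subsetI)
    fix I assume I: "I \<in> {I. I \<subseteq> {1..n} \<and> card I = k}"
    then have "pat I \<sigma> \<in> perms k" using pat_perms[OF assms, of I] by auto
    moreover from this have "I \<in> occ_set (pat I \<sigma>) \<sigma>"
      using I len length_perms[of "pat I \<sigma>" k] by (simp add: occ_set_def)
    ultimately show "I \<in> (\<Union>\<pi>\<in>perms k. occ_set \<pi> \<sigma>)" by blast
  next
    fix I assume "I \<in> (\<Union>\<pi>\<in>perms k. occ_set \<pi> \<sigma>)"
    then obtain \<pi> where "\<pi> \<in> perms k" "I \<in> occ_set \<pi> \<sigma>" by blast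
    then show "I \<in> {I. I \<subseteq> {1..n} \<and> card I = k}"
      using length_perms[of \<pi> k] len by (simp add: occ_set_def)
  qed
  moreover have "card (\<Union>\<pi>\<in>perms k. occ_set \<pi> \<sigma>) = (\<Sum>\<pi>\<in>perms k. card (occ_set \<pi> \<sigma>))"
  proof (rule card_UN_disjoint)
    show "\<forall>\<pi>\<in>perms k. finite (occ_set \<pi> \<sigma>)"
      by (intro ballI finite_occ_set)
  qed (auto simp: occ_set_def)
  ultimately show ?thesis using n_subsets[of "{1..n}" k] by simp
qed

lemma separable_perms_conv_separable: "n \<ge> 1 \<Longrightarrow> separable_perms n = {\<sigma> \<in> separables. length \<sigma> = n}"
  by (auto simp: separables_def separable_perms_def dest: length_perms simp del: One_nat_def)

lemma occ_gf_separable_nth: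
  assumes "n \<ge> 1"
  shows "fps_nth (occ_gf separables \<pi>) n = (\<Sum>\<sigma>\<in>separable_perms n. real (card (occ_set \<pi> \<sigma>)))"
proof -
  have "card (occs \<pi> \<sigma>) = card (occ_set \<pi> \<sigma>)" if "\<sigma> \<in> separables" for \<sigma>
    using separable_is_perm[OF that] card_occ_set[of \<sigma> \<pi>] by (simp add: is_perm_iff)
  then show ?thesis
    unfolding separable_perms_conv_separable[OF assms] occ_gf_def fps_nth_Abs_fps by (intro sum.cong) auto
qed

lemma sum_occ_gf_separable_nth:
  assumes "n \<ge> 1"
  shows "fps_nth (\<Sum>\<pi>\<in>perms k. occ_gf separables \<pi>) n = real (card (separable_perms n)) * real (n choose k)"
proof -
  have "fps_nth (\<Sum>\<pi>\<in>perms k. occ_gf separables \<pi>) n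
      = (\<Sum>\<sigma>\<in>separable_perms n. \<Sum>\<pi>\<in>perms k. real (card (occ_set \<pi> \<sigma>)))"
    unfolding fps_sum_nth occ_gf_separable_nth[OF assms] by (rule sum.swap)
  also have "\<dots> = (\<Sum>\<sigma>\<in>separable_perms n. real (n choose k))"
  proof (rule sum.cong)
    fix \<sigma> assume "\<sigma> \<in> separable_perms n"
    then have "\<sigma> \<in> perms n" by (simp add: separable_perms_def)
    then show "(\<Sum>\<pi>\<in>perms k. real (card (occ_set \<pi> \<sigma>))) = real (n choose k)"
      by (simp only: of_nat_sum[symmetric] sum_occ_set)
  qed simp
  finally show ?thesis by simp
qed

text \<open>The normalization, the number of separable permutations times a binomial coefficient, is
  itself a coefficient of the summed series, so one transfer result handles numerator and
  denominator.\<close>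

lemma expectation_occ_density:
  assumes "\<pi> \<in> perms k" "n \<ge> 1" "n \<ge> k"
  shows "measure_pmf.expectation (pmf_of_set (separable_perms n)) (occ_density \<pi>)
    = fps_nth (occ_gf separables \<pi>) n / fps_nth (\<Sum>\<pi>\<in>perms k. occ_gf separables \<pi>) n"
proof -
  have "measure_pmf.expectation (pmf_of_set (separable_perms n)) (occ_density \<pi>)
      = (\<Sum>\<sigma>\<in>separable_perms n. occ_density \<pi> \<sigma>) / real (card (separable_perms n))"
    by (rule integral_pmf_of_set) (simp_all add: separable_perms_nonempty finite_separable_perms)
  also have "(\<Sum>\<sigma>\<in>separable_perms n. occ_density \<pi> \<sigma>)
      = (\<Sum>\<sigma>\<in>separable_perms n. real (card (occ_set \<pi> \<sigma>)) / real (n choose k))"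
  proof (rule sum.cong)
    fix \<sigma> assume "\<sigma> \<in> separable_perms n"
    then have "length \<sigma> = n" using length_perms by (auto simp: separable_perms_def)
    with assms(3) length_perms[OF assms(1)]
    show "occ_density \<pi> \<sigma> = real (card (occ_set \<pi> \<sigma>)) / real (n choose k)"
      by (simp add: occ_density_def)
  qed simp
  finally show ?thesis
    unfolding occ_gf_separable_nth[OF assms(2)] sum_occ_gf_separable_nth[OF assms(2)]
    by (simp add: mult.commute flip: sum_divide_distrib)
qed

theorem theorem1p3:
  fixes \<pi> :: "nat list" and k :: nat
  assumes "k \<ge> 1" and "\<pi> \<in> perms k"
  shows "(\<lambda>n. measure_pmf.expectation (pmf_of_set (separable_perms n)) (\<lambda>\<sigma>. occ_density \<pi> \<sigma>))
    \<longlonglongrightarrow> real (num_signed_trees \<pi>) / (2 ^ (k - 1) * catalan (k - 1))"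
proof -
  define T where "T = (\<Sum>\<rho>\<in>perms k. occ_gf separables \<rho>)"
  define N where "N = (\<Sum>\<rho>\<in>perms k. real (num_signed_trees \<rho>))"
  have N: "N = 2 ^ (k - 1) * catalan (k - 1)"
    using sum_num_signed_trees[OF assms(1)] card_sign_trees[of "k - 1"]
    by (simp add: N_def flip: of_nat_sum)
  have N_pos: "N > 0" by (simp add: N catalan_def)
  have perm: "is_perm \<rho>" "length \<rho> = k" "\<rho> \<noteq> []" if "\<rho> \<in> perms k" for \<rho>
    using that assms(1) by (auto simp: perms_iff simp del: One_nat_def)
  have "(\<lambda>n. fps_nth (occ_gf separables \<pi>) n / fps_nth T n) \<longlonglongrightarrow> real (num_signed_trees \<pi>) / N"
  \<comment> \<open>For \<open>k = 1\<close> the exponent \<open>2 * k - 1\<close> is too small for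
    \<open>transfer_sqrt_disc\<close>; there is then a single pattern, and the quotient is 1 for all
    \<open>n \<ge> 1\<close>.\<close>
  proof (cases "k = 1")
    case True
    then have one: "perms k = {\<pi>}" using assms(2) by simp
    then have "T = occ_gf separables \<pi>" "N = real (num_signed_trees \<pi>)" by (simp_all only: T_def N_def sum.insert_if) auto
    moreover have "fps_nth T n \<noteq> 0" if "n \<ge> 1" for n
      unfolding T_def sum_occ_gf_separable_nth[OF that]
      using that by (simp add: True finite_separable_perms separable_perms_nonempty)
    then have "eventually (\<lambda>n. fps_nth T n / fps_nth T n = 1) sequentially"
      by (intro eventually_sequentiallyI[of 1]) simp
    then have "(\<lambda>n. fps_nth T n / fps_nth T n) \<longlonglongrightarrow> 1" by (rule tendsto_eventually)
    ultimately show ?thesis using N_pos by simp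
  next
    case False
    with assms(1) have "2 * k - 1 \<ge> 2" by simp
    then obtain B and a :: "nat \<Rightarrow> real" where B: "B \<noteq> 0" and a: "\<And>n. a n \<noteq> 0" and
      lim: "\<And>f c. has_abs_value (sqrt_disc ^ (2 * k - 1) * f) rho c \<Longrightarrow> (\<lambda>n. fps_nth f n / a n) \<longlonglongrightarrow> B * c"
      by (rule transfer_sqrt_disc) (rule that)
    have val: "has_abs_value (sqrt_disc ^ (2 * k - 1) * occ_gf separables \<rho>) rho (2 * real (num_signed_trees \<rho>) * growth ^ k)"
      if "\<rho> \<in> perms k" for \<rho>
      using occ_gf_values perm[OF that] by metis
    have "has_abs_value (sqrt_disc ^ (2 * k - 1) * T) rho (\<Sum>\<rho>\<in>perms k. 2 * real (num_signed_trees \<rho>) * growth ^ k)"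
      unfolding T_def sum_distrib_left by (intro has_abs_value_sum val)
    then have "has_abs_value (sqrt_disc ^ (2 * k - 1) * T) rho (2 * N * growth ^ k)"
      by (simp add: N_def sum_distrib_left sum_distrib_right)
    moreover have "growth \<noteq> 0" using rho_bounds by (simp add: growth_def)
    \<comment> \<open>Both limits share the scale \<open>a n\<close> and the factor
      \<open>B * 2 * growth ^ k\<close>, which cancel and leave the quotient of tree
      numbers.\<close>
    ultimately have "(\<lambda>n. (fps_nth (occ_gf separables \<pi>) n / a n) / (fps_nth T n / a n)) \<longlonglongrightarrow>
        (B * (2 * real (num_signed_trees \<pi>) * growth ^ k)) / (B * (2 * N * growth ^ k))"
      using B N_pos by (intro tendsto_divide lim val assms(2)) auto
    then show ?thesis using a B \<open>growth \<noteq> 0\<close> by simp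
  qed
  moreover have "eventually (\<lambda>n. fps_nth (occ_gf separables \<pi>) n / fps_nth T n =
      measure_pmf.expectation (pmf_of_set (separable_perms n)) (occ_density \<pi>)) sequentially"
    using assms expectation_occ_density[OF assms(2)]
    by (intro eventually_sequentiallyI[of k]) (simp add: T_def)
  ultimately show ?thesis
    unfolding N by (rule Lim_transform_eventually)
qed

end
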